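(* Let $B=(b_{ij})$ be a $k\times k$ symmetric positive semidefinite matrix, and let $(\Omega,\mu)$, $\{X_\sigma\}$, $\widehat f(\sigma)$, $\mathrm{Inf}^{\le m}_j$, $\mathrm{OBJ}$ and $C(B)$ be as in the context. For every $\varepsilon>0$ there exists $\tau>0$ such that for every $n$ and every function $f=(f_1,\dots,f_k):\Omega^n\to\Delta_k$ satisfying $\mathrm{Inf}_j^{\le\log(1/\tau)}(f_i)\le\tau$ for all $i\in\{1,\dots,k\}$ and all $j\in\{1,\dots,n\}$, we have $\mathrm{OBJ}(f)\le C(B)+\varepsilon$.
   Context: Write $b_{ij}=\langle v_i,v_j\rangle$ with $v_i\in\mathbb{R}^k$; let $R(B)$, $w(B)$ be the radius and center of the smallest Euclidean ball containing $v_1,\dots,v_k$, let $p$ be a probability distribution on $\{1,\dots,k\}$ with $w(B)=\sum_i p(i)v_i$ and $p(i)\ne 0$ only if $\|v_i-w(B)\|_2=R(B)$, fix $\beta\in(0,1)$ and let $\mu(i)=(1-\beta)p(i)+\beta/k$ on $\Omega=\{1,\dots,k\}$ (so all $\mu(i)>0$). Let $X_0\equiv1,X_1,\dots,X_{k-1}$ be real functions on $\Omega$ forming an orthonormal basis of $L_2(\Omega,\mu)$. For a multi-index $\sigma\in\{0,\dots,k-1\}^n$ let $X_\sigma(\omega)=\prod_{i=1}^nX_{\sigma_i}(\omega_i)$ on $(\Omega^n,\mu^n)$, $|\sigma|$ the number of nonzero entries of $\sigma$; every $g:\Omega^n\to\mathbb{R}$ is uniquely $g=\sum_\sigma\widehat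 g(\sigma)X_\sigma$. $\mathrm{Inf}^{\le m}_j(g)=\sum_{|\sigma|\le m,\ \sigma_j\ne0}\widehat g(\sigma)^2$. $\Delta_k=\{x\in\mathbb{R}^k: x_i\ge0,\ \sum_ix_i=1\}$. For $f=(f_1,\dots,f_k):\Omega^n\to\Delta_k$, $\mathrm{OBJ}(f)=\sum_{i,j=1}^kb_{ij}\sum_{\sigma:|\sigma|=1}\widehat{f_i}(\sigma)\widehat{f_j}(\sigma)$. $C(B)$ is the maximum over measurable partitions $\{A_1,\dots,A_k\}$ of $\mathbb{R}^{k-1}$ of $\sum_{i,j}b_{ij}\langle z_i,z_j\rangle$, $z_i=\int_{A_i}x\,d\gamma_{k-1}(x)$, $\gamma_{k-1}$ the standard Gaussian measure. *)

theory Defs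
  imports "HOL-Probability.Probability"
begin

definition positive_semidefinite :: "real^'k^'k \<Rightarrow> bool" where
  "positive_semidefinite B \<longleftrightarrow> (\<forall>x. 0 \<le> x \<bullet> (B *v x))"

text \<open>\<open>w\<close> and \<open>R\<close> are the center and the radius of the smallest Euclidean ball containing \<open>V\<close>.\<close>

definition is_smallest_ball :: "'a::euclidean_space \<Rightarrow> real \<Rightarrow> 'a set \<Rightarrow> bool" where
  "is_smallest_ball w R V \<longleftrightarrow>
     V \<subseteq> cball w R \<and> (\<forall>w' R'. V \<subseteq> cball w' R' \<longrightarrow> R \<le> R')"

definition prob_simplex :: "(real^'k) set" where
  "prob_simplex = {x. (\<forall>i. 0 \<le> x $ i) \<and> (\<Sum>i\<in>UNIV. x $ i) = 1}"

text \<open>The alphabet \<open>\<Omega>\<close> is the finite type \<open>'k\<close>, with \<open>k = CARD('k)\<close>. Points of \<open>\<Omega>\<^sup>n\<close> and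
  multi-indices are functions on \<open>{..<n}\<close>; the basis functions \<open>X\<^sub>0, \<dots>, X\<^sub>k\<^sub>-\<^sub>1\<close> are \<open>X 0, \<dots>, X (k - 1)\<close>
  and the values of \<open>X\<close> at larger indices are irrelevant.\<close>

definition inner_L2 :: "('k::finite \<Rightarrow> real) \<Rightarrow> ('k \<Rightarrow> real) \<Rightarrow> ('k \<Rightarrow> real) \<Rightarrow> real" where
  "inner_L2 \<mu> g h = (\<Sum>i\<in>UNIV. \<mu> i * (g i * h i))"

definition orthonormal_basis_L2 :: "('k::finite \<Rightarrow> real) \<Rightarrow> (nat \<Rightarrow> 'k \<Rightarrow> real) \<Rightarrow> bool" where
  "orthonormal_basis_L2 \<mu> X \<longleftrightarrow>
     (\<forall>a<CARD('k). \<forall>b<CARD('k). inner_L2 \<mu> (X a) (X b) = (if a = b then 1 else 0)) \<and>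
     (\<forall>g. \<exists>c. \<forall>i. g i = (\<Sum>a<CARD('k). c a * X a i))"

definition cube :: "nat \<Rightarrow> (nat \<Rightarrow> 'k) set" where
  "cube n = {..<n} \<rightarrow>\<^sub>E UNIV"

definition multi_indices :: "nat \<Rightarrow> nat \<Rightarrow> (nat \<Rightarrow> nat) set" where
  "multi_indices k n = {..<n} \<rightarrow>\<^sub>E {..<k}"

definition weight :: "nat \<Rightarrow> (nat \<Rightarrow> nat) \<Rightarrow> nat" where
  "weight n \<sigma> = card {j. j < n \<and> \<sigma> j \<noteq> 0}"

definition prod_basis :: "(nat \<Rightarrow> 'k \<Rightarrow> real) \<Rightarrow> nat \<Rightarrow> (nat \<Rightarrow> nat) \<Rightarrow> (nat \<Rightarrow> 'k) \<Rightarrow> real" where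
  "prod_basis X n \<sigma> \<omega> = (\<Prod>j<n. X (\<sigma> j) (\<omega> j))"

definition is_expansion ::
    "(nat \<Rightarrow> 'k::finite \<Rightarrow> real) \<Rightarrow> nat \<Rightarrow> ((nat \<Rightarrow> 'k) \<Rightarrow> real) \<Rightarrow> ((nat \<Rightarrow> nat) \<Rightarrow> real) \<Rightarrow> bool" where
  "is_expansion X n g c \<longleftrightarrow>
     c \<in> multi_indices CARD('k) n \<rightarrow>\<^sub>E UNIV \<and>
     (\<forall>\<omega>\<in>cube n. g \<omega> = (\<Sum>\<sigma>\<in>multi_indices CARD('k) n. c \<sigma> * prod_basis X n \<sigma> \<omega>))"

text \<open>The coefficients are those of the unique expansion of \<open>g\<close>; existence and uniqueness are
  \<open>ex1_expansion\<close> below.\<close>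

definition fourier_coeff ::
    "(nat \<Rightarrow> 'k::finite \<Rightarrow> real) \<Rightarrow> nat \<Rightarrow> ((nat \<Rightarrow> 'k) \<Rightarrow> real) \<Rightarrow> (nat \<Rightarrow> nat) \<Rightarrow> real" where
  "fourier_coeff X n g = (THE c. is_expansion X n g c)"

definition low_degree_influence ::
    "(nat \<Rightarrow> 'k::finite \<Rightarrow> real) \<Rightarrow> nat \<Rightarrow> real \<Rightarrow> nat \<Rightarrow> ((nat \<Rightarrow> 'k) \<Rightarrow> real) \<Rightarrow> real" where
  "low_degree_influence X n m j g =
     (\<Sum>\<sigma> | \<sigma> \<in> multi_indices CARD('k) n \<and> real (weight n \<sigma>) \<le> m \<and> \<sigma> j \<noteq> 0.
        (fourier_coeff X n g \<sigma>)\<^sup>2)"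

definition OBJ ::
    "real^'k^'k \<Rightarrow> (nat \<Rightarrow> 'k::finite \<Rightarrow> real) \<Rightarrow> nat \<Rightarrow> ((nat \<Rightarrow> 'k) \<Rightarrow> real^'k) \<Rightarrow> real" where
  "OBJ B X n f =
     (\<Sum>i\<in>UNIV. \<Sum>j\<in>UNIV. B $ i $ j *
        (\<Sum>\<sigma> | \<sigma> \<in> multi_indices CARD('k) n \<and> weight n \<sigma> = 1.
           fourier_coeff X n (\<lambda>\<omega>. f \<omega> $ i) \<sigma> * fourier_coeff X n (\<lambda>\<omega>. f \<omega> $ j) \<sigma>))"

text \<open>The standard Gaussian measure on \<open>\<real>\<^sup>d\<close>, whose points are the (extensional) functions
  on \<open>{..<d}\<close>. An index type would not do, as \<open>d = CARD('k) - 1\<close> may be \<open>0\<close>.\<close>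

definition std_gaussian :: "nat \<Rightarrow> (nat \<Rightarrow> real) measure" where
  "std_gaussian d = (\<Pi>\<^sub>M l\<in>{..<d}. density lborel std_normal_density)"

definition measurable_partitions :: "nat \<Rightarrow> ('k \<Rightarrow> (nat \<Rightarrow> real) set) set" where
  "measurable_partitions d =
     {A. (\<forall>i. A i \<in> sets (std_gaussian d)) \<and> disjoint_family A \<and>
         (\<Union>i. A i) = space (std_gaussian d)}"

definition gaussian_moment :: "nat \<Rightarrow> (nat \<Rightarrow> real) set \<Rightarrow> nat \<Rightarrow> real" where
  "gaussian_moment d S l = (LINT x:S|std_gaussian d. x l)"

definition partition_value :: "real^'k^'k \<Rightarrow> nat \<Rightarrow> ('k::finite \<Rightarrow> (nat \<Rightarrow> real) set) \<Rightarrow> real" where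
  "partition_value B d A =
     (\<Sum>i\<in>UNIV. \<Sum>j\<in>UNIV. B $ i $ j *
        (\<Sum>l<d. gaussian_moment d (A i) l * gaussian_moment d (A j) l))"

text \<open>The maximum over all measurable partitions, written as a supremum, which agrees with it
  whenever it is attained. The set of values is bounded above by \<open>bdd_above_partition_value\<close>
  below, and it is nonempty: one part may be the whole space and the others empty.\<close>

definition C_max :: "real^'k^'k \<Rightarrow> real" where
  "C_max B = (SUP A\<in>measurable_partitions (CARD('k) - 1). partition_value B (CARD('k) - 1) A)"

lemma ex1_expansion:
  fixes X :: "nat \<Rightarrow> 'k::finite \<Rightarrow> real"
  assumes "orthonormal_basis_L2 \<mu> X"
  shows "\<exists>!c. is_expansion X n g c"
proof -
  define k where "k = CARD('k)"
  define M where "M = multi_indices k n"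
  have finM: "finite M" and finC: "finite (cube n :: (nat \<Rightarrow> 'k) set)"
    by (auto simp: M_def multi_indices_def cube_def intro!: finite_PiE)
  have orth: "inner_L2 \<mu> (X a) (X b) = (if a = b then 1 else 0)" if "a < k" "b < k" for a b
    using assms that by (auto simp: orthonormal_basis_L2_def k_def)
  have "\<exists>c. \<forall>i. (if i = i0 then 1 else 0) = (\<Sum>a<k. c a * X a i)" for i0
    using assms by (auto simp: orthonormal_basis_L2_def k_def)
  then obtain e where e: "(if i = i0 then 1 else 0) = (\<Sum>a<k. e i0 a * X a i)" for i i0
    by metis
  have delta: "(if \<omega> = \<omega>0 then 1 else 0) = (\<Sum>\<sigma>\<in>M. (\<Prod>j<n. e (\<omega>0 j) (\<sigma> j)) * prod_basis X n \<sigma> \<omega>)"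
    if "\<omega> \<in> cube n" "\<omega>0 \<in> cube n" for \<omega> \<omega>0 :: "nat \<Rightarrow> 'k"
  proof -
    have "(\<Sum>\<sigma>\<in>M. (\<Prod>j<n. e (\<omega>0 j) (\<sigma> j)) * prod_basis X n \<sigma> \<omega>)
          = (\<Sum>\<sigma>\<in>M. \<Prod>j<n. e (\<omega>0 j) (\<sigma> j) * X (\<sigma> j) (\<omega> j))"
      by (simp add: prod_basis_def prod.distrib)
    also have "\<dots> = (\<Prod>j<n. \<Sum>a<k. e (\<omega>0 j) a * X a (\<omega> j))"
      unfolding M_def multi_indices_def by (subst prod_sum_PiE) auto
    also have "\<dots> = (\<Prod>j<n. if \<omega> j = \<omega>0 j then 1 else 0)"
      by (simp add: e)
    also have "\<dots> = (if \<omega> = \<omega>0 then 1 else 0)"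
    proof (cases "\<omega> = \<omega>0")
      case False
      then have "\<exists>j<n. \<omega> j \<noteq> \<omega>0 j"
        using that PiE_ext[of \<omega> "{..<n}" "\<lambda>_. UNIV" \<omega>0] unfolding cube_def by blast
      then have "(\<Prod>j<n. if \<omega> j = \<omega>0 j then 1 else 0 :: real) = 0"
        by (intro prod_zero) auto
      then show ?thesis using False by simp
    qed simp
    finally show ?thesis by simp
  qed
  define c where "c = restrict (\<lambda>\<sigma>. \<Sum>\<omega>0\<in>cube n. g \<omega>0 * (\<Prod>j<n. e (\<omega>0 j) (\<sigma> j))) M"
  have "g \<omega> = (\<Sum>\<sigma>\<in>M. c \<sigma> * prod_basis X n \<sigma> \<omega>)" if "\<omega> \<in> cube n" for \<omega>
  proof -
    have "g \<omega> = (\<Sum>\<omega>0\<in>cube n. g \<omega>0 * (if \<omega> = \<omega>0 then 1 else 0))"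
      using finC that by (simp add: mult_delta_right)
    also have "\<dots> = (\<Sum>\<omega>0\<in>cube n. g \<omega>0 * (\<Sum>\<sigma>\<in>M. (\<Prod>j<n. e (\<omega>0 j) (\<sigma> j)) * prod_basis X n \<sigma> \<omega>))"
      using that delta by (intro sum.cong) auto
    also have "\<dots> = (\<Sum>\<sigma>\<in>M. c \<sigma> * prod_basis X n \<sigma> \<omega>)"
      by (simp add: c_def sum_distrib_left sum_distrib_right mult.assoc) (rule sum.swap)
    finally show ?thesis .
  qed
  moreover have "c \<in> M \<rightarrow>\<^sub>E UNIV"
    by (simp add: c_def)
  ultimately have ex: "is_expansion X n g c"
    unfolding is_expansion_def M_def k_def by blast
  have coeff: "c' \<tau> = (\<Sum>\<omega>\<in>cube n. (\<Prod>j<n. \<mu> (\<omega> j)) * g \<omega> * prod_basis X n \<tau> \<omega>)"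
    if c': "is_expansion X n g c'" and \<tau>: "\<tau> \<in> M" for c' \<tau>
  proof -
    have on: "(\<Sum>\<omega>\<in>cube n. (\<Prod>j<n. \<mu> (\<omega> j)) * prod_basis X n \<sigma> \<omega> * prod_basis X n \<tau> \<omega>)
              = (if \<sigma> = \<tau> then 1 else 0)" if \<sigma>: "\<sigma> \<in> M" for \<sigma>
    proof -
      have "(\<Sum>\<omega>\<in>cube n. (\<Prod>j<n. \<mu> (\<omega> j)) * prod_basis X n \<sigma> \<omega> * prod_basis X n \<tau> \<omega>)
            = (\<Sum>\<omega>\<in>cube n. \<Prod>j<n. \<mu> (\<omega> j) * (X (\<sigma> j) (\<omega> j) * X (\<tau> j) (\<omega> j)))"
        by (simp add: prod_basis_def prod.distrib mult.assoc)
      also have "\<dots> = (\<Prod>j<n. inner_L2 \<mu> (X (\<sigma> j)) (X (\<tau> j)))"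
        unfolding cube_def inner_L2_def by (subst prod_sum_PiE) auto
      also have "\<dots> = (\<Prod>j<n. if \<sigma> j = \<tau> j then 1 else 0)"
        using \<sigma> \<tau> by (intro prod.cong orth refl) (auto simp: M_def multi_indices_def PiE_iff)
      also have "\<dots> = (if \<sigma> = \<tau> then 1 else 0)"
      proof (cases "\<sigma> = \<tau>")
        case False
        then have "\<exists>j<n. \<sigma> j \<noteq> \<tau> j"
          using \<sigma> \<tau> PiE_ext[of \<sigma> "{..<n}" "\<lambda>_. {..<k}" \<tau>]
          unfolding M_def multi_indices_def by blast
        then have "(\<Prod>j<n. if \<sigma> j = \<tau> j then 1 else 0 :: real) = 0"
          by (intro prod_zero) auto
        then show ?thesis using False by simp
      qed simp
      finally show ?thesis .
    qed
    have g: "g \<omega> = (\<Sum>\<sigma>\<in>M. c' \<sigma> * prod_basis X n \<sigma> \<omega>)" if "\<omega> \<in> cube n" for \<omega>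
      using c' that unfolding is_expansion_def M_def k_def by blast
    have "(\<Sum>\<omega>\<in>cube n. (\<Prod>j<n. \<mu> (\<omega> j)) * g \<omega> * prod_basis X n \<tau> \<omega>)
          = (\<Sum>\<omega>\<in>cube n. \<Sum>\<sigma>\<in>M. c' \<sigma> * ((\<Prod>j<n. \<mu> (\<omega> j)) * prod_basis X n \<sigma> \<omega> * prod_basis X n \<tau> \<omega>))"
      by (intro sum.cong refl, subst g)
        (simp_all add: sum_distrib_left sum_distrib_right mult_ac)
    also have "\<dots> = (\<Sum>\<sigma>\<in>M. c' \<sigma> * (if \<sigma> = \<tau> then 1 else 0))"
      by (subst sum.swap) (simp add: sum_distrib_left[symmetric] on)
    also have "\<dots> = c' \<tau>" using finM \<tau> by (simp add: mult_delta_right)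
    finally show ?thesis by simp
  qed
  show ?thesis
  proof (rule ex1I[of _ c])
    fix c' assume c': "is_expansion X n g c'"
    show "c' = c"
    proof (rule PiE_ext)
      show "c' \<in> M \<rightarrow>\<^sub>E UNIV" "c \<in> M \<rightarrow>\<^sub>E UNIV"
        using c' ex unfolding is_expansion_def M_def k_def by blast+
    qed (simp add: coeff[OF c'] coeff[OF ex])
  qed (rule ex)
qed

lemma integrable_std_gaussian_coordinate:
  assumes "l < d"
  shows "integrable (std_gaussian d) (\<lambda>x. x l)"
proof -
  let ?N = "density lborel std_normal_density"
  interpret N: prob_space ?N
    by (rule prob_space_normal_density) simp
  interpret P: product_prob_space "\<lambda>_. ?N" "{..<d}"
    by standard
  have "integrable ?N (\<lambda>x. x)"
    using integrable_std_normal_moment[of 1] by (subst integrable_density) auto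
  then have "integrable (distr (std_gaussian d) ?N (\<lambda>x. x l)) (\<lambda>x. x)"
    using assms unfolding std_gaussian_def by (subst P.PiM_component) auto
  then show ?thesis
    using assms unfolding std_gaussian_def by (subst (asm) integrable_distr_eq) auto
qed

lemma bdd_above_partition_value:
  fixes B :: "real^'k^'k"
  shows "bdd_above (partition_value B d ` measurable_partitions d)"
proof -
  define K where "K l = (\<integral>x. \<bar>x l\<bar> \<partial>std_gaussian d)" for l
  have K: "\<bar>gaussian_moment d S l\<bar> \<le> K l" if "S \<in> sets (std_gaussian d)" "l < d" for S l
  proof -
    have "\<bar>gaussian_moment d S l\<bar> \<le> (\<integral>x. \<bar>indicator S x *\<^sub>R x l\<bar> \<partial>std_gaussian d)"
      unfolding gaussian_moment_def set_lebesgue_integral_def by (rule integral_abs_bound)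
    also have "\<dots> \<le> K l"
      unfolding K_def using integrable_std_gaussian_coordinate[OF that(2)] that(1)
      by (intro integral_mono integrable_abs integrable_mult_indicator) (auto split: split_indicator)
    finally show ?thesis .
  qed
  show ?thesis
  proof (rule bdd_aboveI2)
    fix A :: "'k \<Rightarrow> (nat \<Rightarrow> real) set" assume A: "A \<in> measurable_partitions d"
    show "partition_value B d A \<le> (\<Sum>i\<in>UNIV. \<Sum>j\<in>UNIV. \<bar>B $ i $ j\<bar> * (\<Sum>l<d. K l * K l))"
      unfolding partition_value_def
    proof (intro sum_mono)
      fix i j
      let ?s = "\<Sum>l<d. gaussian_moment d (A i) l * gaussian_moment d (A j) l"
      have "\<bar>?s\<bar> \<le> (\<Sum>l<d. \<bar>gaussian_moment d (A i) l\<bar> * \<bar>gaussian_moment d (A j) l\<bar>)"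
        by (rule order_trans[OF sum_abs]) (simp add: abs_mult)
      also have "\<dots> \<le> (\<Sum>l<d. K l * K l)"
        using A by (intro sum_mono mult_mono' K) (auto simp: measurable_partitions_def)
      finally have "\<bar>B $ i $ j * ?s\<bar> \<le> \<bar>B $ i $ j\<bar> * (\<Sum>l<d. K l * K l)"
        by (simp add: abs_mult mult_left_mono)
      then show "B $ i $ j * ?s \<le> \<bar>B $ i $ j\<bar> * (\<Sum>l<d. K l * K l)"
        by linarith
    qed
  qed
qed

end

theory Submission
  imports Defs "HOL-Real_Asymp.Real_Asymp"
begin

text \<open>
  Only the level-one coefficients matter, so hypercontractivity is not needed. Let \<open>z\<^sub>i\<close> be the vector of
  level-one coefficients of \<open>f\<^sub>i\<close>, let \<open>m s = (\<Sum>i. z\<^sub>i s *\<^sub>R v\<^sub>i)\<close> and \<open>r = sqrt OBJ\<close>, so that \<open>r\<^sup>2\<close> is the sum of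
  the \<open>|m s|\<^sup>2\<close>. With \<open>a s = (\<langle>v\<^sub>i, m s\<rangle> / r)\<^sub>i\<close> and \<open>Y = (\<Sum>s. X\<^sub>s *\<^sub>R a s)\<close>, a random vector in \<open>\<real>\<^sup>k\<close>,
  duality gives \<open>r = E (\<Sum>i. f\<^sub>i Y\<^sub>i) \<le> E (max\<^sub>i Y\<^sub>i)\<close>, because \<open>f\<close> takes values in the simplex.
  If \<open>OBJ \<le> \<epsilon>\<close> there is nothing to show; otherwise \<open>r\<close> is bounded below and small influences make all
  \<open>a s\<close> small. Smoothing the maximum to \<open>ln (\<Sum>i. exp (\<theta> y\<^sub>i)) / \<theta>\<close>, a Lindeberg replacement then
  exchanges \<open>Y\<close> for a Gaussian vector with the same covariance. As the \<open>z\<^sub>i\<close> sum to zero, this vector can be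
  written as \<open>(\<langle>v\<^sub>i, M G\<rangle>)\<^sub>i\<close> with \<open>G\<close> standard Gaussian in \<open>\<real>\<^sup>k\<^sup>-\<^sup>1\<close> and \<open>M\<close> of Frobenius norm one. Splitting its
  expected maximum over the partition by the index that attains it and using Cauchy--Schwarz bounds it
  by \<open>sqrt (C B)\<close>.
\<close>

section \<open>Soft maximum\<close>

definition softmax :: "real \<Rightarrow> real^'k::finite \<Rightarrow> real" where
  "softmax \<theta> y = ln (\<Sum>i\<in>UNIV. exp (\<theta> * y $ i)) / \<theta>"

lemma softmax_ge:
  assumes "\<theta> > 0"
  shows "y $ i \<le> softmax \<theta> y"
proof -
  have "exp (\<theta> * y $ i) \<le> (\<Sum>i\<in>UNIV. exp (\<theta> * y $ i))"
    by (rule member_le_sum) auto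
  then have "\<theta> * y $ i \<le> ln (\<Sum>i\<in>UNIV. exp (\<theta> * y $ i))"
    by (subst ln_ge_iff) (auto intro: sum_pos)
  then show ?thesis
    using assms by (simp add: softmax_def field_simps)
qed

lemma softmax_le:
  fixes y :: "real^'k::finite"
  assumes "\<theta> > 0" "\<And>i. y $ i \<le> m"
  shows "softmax \<theta> y \<le> m + ln CARD('k) / \<theta>"
proof -
  have "(\<Sum>i\<in>UNIV. exp (\<theta> * y $ i)) \<le> (\<Sum>i\<in>(UNIV::'k set). exp (\<theta> * m))"
    using assms by (intro sum_mono) auto
  then have "ln (\<Sum>i\<in>UNIV. exp (\<theta> * y $ i)) \<le> ln (CARD('k) * exp (\<theta> * m))"
    by (intro ln_mono) (auto intro: sum_pos)
  also have "\<dots> = ln CARD('k) + \<theta> * m"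
    by (subst ln_mult) auto
  finally show ?thesis
    using assms by (simp add: softmax_def field_simps)
qed

text \<open>Replacing \<open>y\<close> by \<open>x\<close> changes every exponent by at most
  \<theta> times the distance of the two points, so the logarithm moves by no more than that, and
  dividing by \<theta> leaves slope one.\<close>

lemma softmax_lipschitz:
  assumes "\<theta> > 0"
  shows "1-lipschitz_on UNIV (softmax \<theta> :: real^'k \<Rightarrow> real)"
proof -
  have *: "softmax \<theta> x \<le> softmax \<theta> y + norm (x - y)" for x y :: "real^'k"
  proof -
    have "(\<Sum>i\<in>UNIV. exp (\<theta> * x $ i)) \<le> (\<Sum>i\<in>UNIV. exp (\<theta> * norm (x - y)) * exp (\<theta> * y $ i))"
    proof (rule sum_mono)
      fix i
      have "x $ i \<le> norm (x - y) + y $ i"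
        using component_le_norm_cart[of "x - y" i] by simp
      then have "\<theta> * x $ i \<le> \<theta> * (norm (x - y) + y $ i)"
        using assms by (intro mult_left_mono) auto
      then show "exp (\<theta> * x $ i) \<le> exp (\<theta> * norm (x - y)) * exp (\<theta> * y $ i)"
        by (simp add: exp_add[symmetric] algebra_simps)
    qed
    then have "ln (\<Sum>i\<in>UNIV. exp (\<theta> * x $ i))
        \<le> ln (exp (\<theta> * norm (x - y)) * (\<Sum>i\<in>UNIV. exp (\<theta> * y $ i)))"
      by (intro ln_mono) (auto intro: sum_pos simp: sum_distrib_left)
    also have "\<dots> = \<theta> * norm (x - y) + ln (\<Sum>i\<in>UNIV. exp (\<theta> * y $ i))"
      by (subst ln_mult) (auto intro!: sum_pos less_imp_neq[symmetric] simp: sum_nonneg_eq_0_iff)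
    finally show ?thesis
      using assms by (simp add: softmax_def field_simps)
  qed
  show ?thesis
  proof (rule lipschitz_onI)
    fix x y :: "real^'k"
    show "dist (softmax \<theta> x) (softmax \<theta> y) \<le> 1 * dist x y"
      using *[of x y] *[of y x] by (simp add: dist_norm norm_minus_commute abs_le_iff)
  qed simp
qed

text \<open>Along the line \<open>y + t h\<close> this is a rescaled cumulant generating function:
  its first three derivatives in \<open>t\<close> are cumulants of the coordinates of
  \<open>h\<close> under Gibbs weights, times 1, \<theta> and \<theta>^2. The coefficients are fixed
  before \<open>h\<close>, so that the quadratic polynomial can later be integrated over
  \<open>h\<close>.\<close>

lemma softmax_taylor:
  fixes y :: "real^'k::finite"
  assumes \<theta>: "\<theta> > 0"
  obtains p q where
    "\<And>h. \<bar>softmax \<theta> (y + h) - (softmax \<theta> y + (\<Sum>i\<in>UNIV. p i * h $ i) +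
        (\<Sum>i\<in>UNIV. \<Sum>j\<in>UNIV. q i j * (h $ i * h $ j)))\<bar> \<le> \<theta>\<^sup>2 * norm h ^ 3"
proof -
  define Z where "Z = (\<Sum>i\<in>UNIV. exp (\<theta> * y $ i))"
  have Z: "Z > 0" unfolding Z_def by (rule sum_pos) auto
  define P where "P i = exp (\<theta> * y $ i) / Z" for i
  \<comment> \<open>Half the Hessian at \<open>y\<close>, which is \<theta> times the covariance
    matrix of a random unit coordinate vector drawn with the Gibbs weights \<open>P\<close>.\<close>
  define Q where "Q i j = \<theta> / 2 * ((if i = j then P i else 0) - P i * P j)" for i j
  have "\<bar>softmax \<theta> (y + h) - (softmax \<theta> y + (\<Sum>i\<in>UNIV. P i * h $ i) +
        (\<Sum>i\<in>UNIV. \<Sum>j\<in>UNIV. Q i j * (h $ i * h $ j)))\<bar> \<le> \<theta>\<^sup>2 * norm h ^ 3" for h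
  proof -
    \<comment> \<open>Unnormalised Gibbs moments of the coordinates of \<open>h\<close> at time
      \<open>t\<close>: differentiation raises the order by one and costs a factor \<theta>.
      Dividing by \<open>S 0\<close> gives the moments \<open>r\<close> below.\<close>
    define S where "S m t = (\<Sum>i\<in>UNIV. (h $ i) ^ m * exp (\<theta> * (y $ i + t * h $ i)))" for m :: nat and t
    have S0: "S 0 t > 0" for t
      unfolding S_def by (rule sum_pos) auto
    have dS: "(S m has_real_derivative \<theta> * S (Suc m) t) (at t)" for m t
      unfolding S_def by (auto intro!: derivative_eq_intros simp: sum_distrib_left mult_ac)
    note [derivative_intros] = DERIV_chain2[OF dS]
    have bS: "\<bar>S m t\<bar> \<le> norm h ^ m * S 0 t" for m t
    proof -
      have "\<bar>S m t\<bar> \<le> (\<Sum>i\<in>UNIV. norm h ^ m * exp (\<theta> * (y $ i + t * h $ i)))"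
        unfolding S_def
        by (rule order_trans[OF sum_abs], rule sum_mono)
          (auto simp: abs_mult power_abs intro!: power_mono component_le_norm_cart)
      then show ?thesis by (simp add: S_def sum_distrib_left)
    qed
    define r where "r m t = S m t / S 0 t" for m t
    have br: "\<bar>r m t\<bar> \<le> norm h ^ m" for m t
      using bS[of m t] S0[of t] by (simp add: r_def field_simps)
    have dr: "(r m has_real_derivative \<theta> * (r (Suc m) t - r m t * r 1 t)) (at t)" for m t
      unfolding r_def using S0[of t]
      by (auto intro!: derivative_eq_intros simp: field_simps)
    note [derivative_intros] = DERIV_chain2[OF dr]
    \<comment> \<open>The soft maximum along the line, then mean, variance and third cumulant
      written in the moments \<open>r\<close>.\<close>
    define diff where "diff m = (if m = 0 then (\<lambda>t. ln (S 0 t) / \<theta>) else if m = 1 then r 1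
       else if m = 2 then (\<lambda>t. \<theta> * (r 2 t - r 1 t ^ 2))
       else (\<lambda>t. \<theta>\<^sup>2 * (r 3 t - 3 * r 2 t * r 1 t + 2 * r 1 t ^ 3)))" for m :: nat
    have d0: "((\<lambda>t. ln (S 0 t) / \<theta>) has_real_derivative r 1 t) (at t)" for t
      using S0[of t] \<theta> by (auto intro!: derivative_eq_intros simp: r_def field_simps)
    have d1: "(r 1 has_real_derivative \<theta> * (r 2 t - r 1 t ^ 2)) (at t)" for t
      using dr[of 1 t] by (simp add: power2_eq_square numeral_2_eq_2)
    have d2: "((\<lambda>t. \<theta> * (r 2 t - r 1 t ^ 2)) has_real_derivative
        \<theta>\<^sup>2 * (r 3 t - 3 * r 2 t * r 1 t + 2 * r 1 t ^ 3)) (at t)" for t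
      by (auto intro!: derivative_eq_intros simp: numeral_3_eq_3 numeral_2_eq_2 algebra_simps)
    have "\<exists>t>0. t < 1 \<and> diff 0 1 = (\<Sum>m<3. (diff m 0 / fact m) * 1 ^ m) + (diff 3 t / fact 3) * 1 ^ 3"
    proof (rule Maclaurin)
      show "\<forall>m t. m < 3 \<and> 0 \<le> t \<and> t \<le> 1 \<longrightarrow> (diff m has_real_derivative diff (Suc m) t) (at t)"
      proof (intro allI impI)
        fix m :: nat and t :: real
        assume "m < 3 \<and> 0 \<le> t \<and> t \<le> 1"
        then have "m = 0 \<or> m = 1 \<or> m = 2" by auto
        then show "(diff m has_real_derivative diff (Suc m) t) (at t)"
          using d0 d1 d2 by (auto simp: diff_def numeral_2_eq_2[symmetric])
      qed
    qed auto
    moreover have "(\<Sum>m<3. g m) = g 0 + g 1 + g 2" for g :: "nat \<Rightarrow> real"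
      by (simp add: numeral_3_eq_3 numeral_2_eq_2)
    ultimately obtain t where t: "diff 0 1 = diff 0 0 + diff 1 0 + diff 2 0 / 2 + diff 3 t / 6"
      by (auto simp: fact_numeral)
    have "diff 0 1 = softmax \<theta> (y + h)" "diff 0 0 = softmax \<theta> y"
      by (simp_all add: diff_def softmax_def S_def)
    moreover have "diff 1 0 = (\<Sum>i\<in>UNIV. P i * h $ i)"
      by (simp add: diff_def r_def S_def P_def Z_def sum_divide_distrib mult_ac)
    moreover have "diff 2 0 / 2 = (\<Sum>i\<in>UNIV. \<Sum>j\<in>UNIV. Q i j * (h $ i * h $ j))"
    proof -
      have r1: "r 1 0 = (\<Sum>i\<in>UNIV. P i * h $ i)"
        by (simp add: r_def S_def P_def Z_def sum_divide_distrib mult_ac)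
      have r2: "r 2 0 = (\<Sum>i\<in>UNIV. P i * (h $ i)\<^sup>2)"
        by (simp add: r_def S_def P_def Z_def sum_divide_distrib mult_ac)
      have "(\<Sum>i\<in>UNIV. \<Sum>j\<in>UNIV. Q i j * (h $ i * h $ j)) =
        (\<Sum>i\<in>UNIV. \<Sum>j\<in>UNIV. (if i = j then \<theta> / 2 * (P i * (h $ i)\<^sup>2) else 0)
            - \<theta> / 2 * ((P i * h $ i) * (P j * h $ j)))"
        by (intro sum.cong refl) (auto simp: Q_def algebra_simps power2_eq_square)
      also have "\<dots> = \<theta> / 2 * r 2 0 - \<theta> / 2 * (r 1 0 * r 1 0)"
        unfolding sum_subtractf r1 r2 sum_product by (simp add: sum_distrib_left)
      also have "\<dots> = \<theta> / 2 * (r 2 0 - r 1 0 ^ 2)"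
        by (simp add: power2_eq_square algebra_simps)
      finally show ?thesis by (simp add: diff_def)
    qed
    moreover have "\<bar>diff 3 t / 6\<bar> \<le> \<theta>\<^sup>2 * norm h ^ 3"
    proof -
      have 1: "\<bar>r 2 t * r 1 t\<bar> \<le> norm h ^ 2 * norm h ^ 1"
        unfolding abs_mult by (intro mult_mono br) auto
      have 2: "\<bar>r 1 t ^ 3\<bar> \<le> norm h ^ 3"
        using br[of 1 t] by (auto simp: power_abs intro!: power_mono)
      \<comment> \<open>The coefficients 1, 3 and 2 of the third cumulant add up to 6, which cancels
        the factorial in the Taylor remainder.\<close>
      have "\<bar>r 3 t - 3 * (r 2 t * r 1 t) + 2 * r 1 t ^ 3\<bar> \<le> 6 * norm h ^ 3"
        using br[of 3 t] 1 2 by (simp add: power3_eq_cube power2_eq_square)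
      then have "\<theta>\<^sup>2 * \<bar>r 3 t - 3 * (r 2 t * r 1 t) + 2 * r 1 t ^ 3\<bar> \<le> \<theta>\<^sup>2 * (6 * norm h ^ 3)"
        by (intro mult_left_mono) auto
      then show ?thesis
        by (simp add: diff_def abs_mult mult.assoc)
    qed
    ultimately show ?thesis using t by linarith
  qed
  then show ?thesis by (rule that)
qed

section \<open>Averaging operators\<close>

text \<open>A 1-Lipschitz function grows at most linearly, so a first moment suffices to average
  it.\<close>

definition integrable_law :: "'a::euclidean_space measure \<Rightarrow> bool" where
  "integrable_law M \<longleftrightarrow> prob_space M \<and> sets M = sets borel \<and> integrable M norm"

text \<open>Laws act as operators on functions. Composing two of them corresponds to adding
  independent increments, so sums of independent vectors are treated without a joint probability
  space.\<close>

definition avg :: "'a::euclidean_space measure \<Rightarrow> ('a \<Rightarrow> real) \<Rightarrow> 'a \<Rightarrow> real" where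
  "avg M F x = (\<integral>h. F (x + h) \<partial>M)"

lemma lipschitz_borel:
  fixes F :: "'a::euclidean_space \<Rightarrow> real"
  assumes "1-lipschitz_on UNIV F"
  shows "F \<in> borel_measurable borel"
  using lipschitz_on_continuous_on[OF assms] by (rule borel_measurable_continuous_onI)

lemma lipschitz_diff:
  fixes F :: "'a::euclidean_space \<Rightarrow> real"
  assumes "1-lipschitz_on UNIV F"
  shows "\<bar>F x - F y\<bar> \<le> norm (x - y)"
  using lipschitz_onD[OF assms, of x y] by (simp add: dist_norm)

lemma lipschitz_abs_le:
  fixes F :: "'a::euclidean_space \<Rightarrow> real"
  assumes "1-lipschitz_on UNIV F"
  shows "\<bar>F (x + h)\<bar> \<le> \<bar>F x\<bar> + norm h"
  using lipschitz_diff[OF assms, of "x + h" x] by simp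

lemma integrable_avg:
  fixes F :: "'a::euclidean_space \<Rightarrow> real"
  assumes M: "integrable_law M" and F: "1-lipschitz_on UNIV F"
  shows "integrable M (\<lambda>h. F (x + h))"
proof -
  interpret prob_space M using M by (simp add: integrable_law_def)
  have [measurable_cong]: "sets M = sets borel" using M by (simp add: integrable_law_def)
  note [measurable] = lipschitz_borel[OF F]
  have "integrable M (\<lambda>h. \<bar>F x\<bar> + norm h)"
    using M by (auto simp: integrable_law_def)
  then show ?thesis
    by (rule Bochner_Integration.integrable_bound) (auto intro!: AE_I2 order_trans[OF lipschitz_abs_le[OF F]])
qed

lemma avg_diff_le:
  assumes M: "integrable_law M" and F: "1-lipschitz_on UNIV F" "1-lipschitz_on UNIV G"
    and e: "\<And>h. \<bar>F (x + h) - G (y + h)\<bar> \<le> e"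
  shows "\<bar>avg M F x - avg M G y\<bar> \<le> e"
proof -
  interpret prob_space M using M by (simp add: integrable_law_def)
  note int = integrable_avg[OF M F(1), of x] integrable_avg[OF M F(2), of y]
  have "\<bar>avg M F x - avg M G y\<bar> = \<bar>\<integral>h. F (x + h) - G (y + h) \<partial>M\<bar>"
    using int by (simp add: avg_def)
  also have "\<dots> \<le> (\<integral>h. \<bar>F (x + h) - G (y + h)\<bar> \<partial>M)"
    by (rule integral_abs_bound)
  also have "\<dots> \<le> (\<integral>h. e \<partial>M)"
    using int e by (intro integral_mono) auto
  finally show ?thesis by (simp add: prob_space)
qed

lemma avg_lipschitz:
  assumes M: "integrable_law M" and F: "1-lipschitz_on UNIV F"
  shows "1-lipschitz_on UNIV (avg M F)"
proof (rule lipschitz_onI)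
  fix x y :: 'a
  have "\<bar>F (x + h) - F (y + h)\<bar> \<le> norm (x - y)" for h
    using lipschitz_diff[OF F, of "x + h" "y + h"] by simp
  then show "dist (avg M F x) (avg M F y) \<le> 1 * dist x y"
    using avg_diff_le[OF M F F] by (simp add: dist_norm)
qed simp

text \<open>Fubini: the linear growth of \<open>F\<close> and the two first moments provide the
  joint integrability.\<close>

lemma avg_commute:
  assumes M: "integrable_law M" and N: "integrable_law N" and F: "1-lipschitz_on UNIV F"
  shows "avg M (avg N F) = avg N (avg M F)"
proof
  fix x
  interpret M: prob_space M using M by (simp add: integrable_law_def)
  interpret N: prob_space N using N by (simp add: integrable_law_def)
  interpret MN: pair_prob_space M N ..
  have [measurable_cong]: "sets M = sets borel" "sets N = sets borel"
    using M N by (simp_all add: integrable_law_def)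
  note [measurable] = lipschitz_borel[OF F]
  have "integrable (M \<Otimes>\<^sub>M N) (\<lambda>(h, k). F (x + h + k))"
  proof (rule MN.Fubini_integrable)
    let ?c = "\<integral>k. norm k \<partial>N"
    show "integrable M (\<lambda>h. \<integral>k. norm (case (h, k) of (h, k) \<Rightarrow> F (x + h + k)) \<partial>N)"
    proof (rule Bochner_Integration.integrable_bound)
      show "integrable M (\<lambda>h. \<bar>F x\<bar> + norm h + ?c)"
        using M by (auto simp: integrable_law_def)
      show "AE h in M. norm (\<integral>k. norm (case (h, k) of (h, k) \<Rightarrow> F (x + h + k)) \<partial>N)
          \<le> norm (\<bar>F x\<bar> + norm h + ?c)"
      proof (rule AE_I2)
        fix h
        have "(\<integral>k. \<bar>F (x + h + k)\<bar> \<partial>N) \<le> (\<integral>k. \<bar>F x\<bar> + norm h + norm k \<partial>N)"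
        proof (rule integral_mono)
          show "integrable N (\<lambda>k. \<bar>F (x + h + k)\<bar>)"
            using integrable_avg[OF N F] by (rule integrable_abs)
          show "integrable N (\<lambda>k. \<bar>F x\<bar> + norm h + norm k)"
            using N by (auto simp: integrable_law_def)
          show "\<bar>F (x + h + k)\<bar> \<le> \<bar>F x\<bar> + norm h + norm k" for k
            using lipschitz_abs_le[OF F, of "x + h" k] lipschitz_abs_le[OF F, of x h] by linarith
        qed
        also have "\<dots> = \<bar>F x\<bar> + norm h + ?c"
          using N by (simp add: integrable_law_def N.prob_space)
        finally show "norm (\<integral>k. norm (case (h, k) of (h, k) \<Rightarrow> F (x + h + k)) \<partial>N)
          \<le> norm (\<bar>F x\<bar> + norm h + ?c)" by simp
      qed
    qed simp
    show "AE h in M. integrable N (\<lambda>k. case (h, k) of (h, k) \<Rightarrow> F (x + h + k))"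
      using integrable_avg[OF N F] by simp
  qed simp
  from MN.Fubini_integral[OF this]
  show "avg M (avg N F) x = avg N (avg M F) x"
    by (simp add: avg_def ac_simps)
qed

abbreviation avgs :: "('j \<Rightarrow> 'a::euclidean_space measure) \<Rightarrow> 'j list \<Rightarrow> ('a \<Rightarrow> real) \<Rightarrow> 'a \<Rightarrow> real" where
  "avgs U js F \<equiv> foldr (\<lambda>j. avg (U j)) js F"

lemma avgs_lipschitz:
  assumes "\<And>j. j \<in> set js \<Longrightarrow> integrable_law (U j)" and "1-lipschitz_on UNIV F"
  shows "1-lipschitz_on UNIV (avgs U js F)"
  using assms by (induction js) (auto intro: avg_lipschitz)

lemma avg_avgs_commute:
  assumes "\<And>j. j \<in> set js \<Longrightarrow> integrable_law (U j)" and "integrable_law M" and "1-lipschitz_on UNIV F"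
  shows "avg M (avgs U js F) = avgs U js (avg M F)"
  using assms
proof (induction js)
  case (Cons j js)
  then have "avg M (avg (U j) (avgs U js F)) = avg (U j) (avg M (avgs U js F))"
    by (intro avg_commute avgs_lipschitz) auto
  also have "avg M (avgs U js F) = avgs U js (avg M F)"
    using Cons by simp
  finally show ?case by simp
qed simp

lemma avgs_diff_le:
  assumes "\<And>h. \<bar>F h - G h\<bar> \<le> e" and "1-lipschitz_on UNIV F" "1-lipschitz_on UNIV G"
    and "\<And>j. j \<in> set js \<Longrightarrow> integrable_law (U j)"
  shows "\<bar>avgs U js F x - avgs U js G x\<bar> \<le> e"
  using assms(4)
proof (induction js arbitrary: x)
  case Nil then show ?case using assms(1) by simp
next
  case (Cons j js)
  then have "\<bar>avg (U j) (avgs U js F) x - avg (U j) (avgs U js G) x\<bar> \<le> e"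
    by (intro avg_diff_le avgs_lipschitz assms(2,3)) auto
  then show ?case by simp
qed

text \<open>Lindeberg's telescoping. Laws are exchanged one at a time. As averages commute, the law
  being exchanged can be applied to \<open>F\<close> first, where the bound \<open>e j\<close> is
  assumed, and the remaining averages do not enlarge a uniform error.\<close>

lemma avgs_replace:
  assumes U: "\<And>j. j \<in> set js \<Longrightarrow> integrable_law (U j)"
    and V: "\<And>j. j \<in> set js \<Longrightarrow> integrable_law (V j)"
    and F: "1-lipschitz_on UNIV F"
    and e: "\<And>j x. j \<in> set js \<Longrightarrow> \<bar>avg (U j) F x - avg (V j) F x\<bar> \<le> e j"
  shows "\<bar>avgs U js F x - avgs V js F x\<bar> \<le> (\<Sum>j\<leftarrow>js. e j)"
  using U V e
proof (induction js arbitrary: x)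
  case (Cons j js)
  have "\<bar>avg (U j) (avgs U js F) x - avg (U j) (avgs V js F) x\<bar> \<le> (\<Sum>j\<leftarrow>js. e j)"
    using Cons by (intro avg_diff_le avgs_lipschitz F) auto
  moreover have "\<bar>avg (U j) (avgs V js F) x - avg (V j) (avgs V js F) x\<bar> \<le> e j"
  proof -
    have "\<bar>avgs V js (avg (U j) F) x - avgs V js (avg (V j) F) x\<bar> \<le> e j"
      using Cons by (intro avgs_diff_le avg_lipschitz F) auto
    then show ?thesis
      using Cons F by (simp add: avg_avgs_commute)
  qed
  ultimately show ?case by simp
qed simp

lemma borel_measurable_vec_nth: "(\<lambda>h :: real^'k::finite. h $ i) \<in> borel_measurable borel"
  by (intro borel_measurable_continuous_onI continuous_intros)

text \<open>The quadratic Taylor polynomial at \<open>x\<close> has the same mean under both laws,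
  so only the two cubic remainders survive.\<close>

lemma avg_softmax_diff_le:
  fixes M N :: "(real^'k::finite) measure"
  assumes M: "integrable_law M" and N: "integrable_law N" and \<theta>: "\<theta> > 0"
    and M3: "integrable M (\<lambda>h. norm h ^ 3)" and N3: "integrable N (\<lambda>h. norm h ^ 3)"
    and m1: "\<And>i. (\<integral>h. h $ i \<partial>M) = (\<integral>h. h $ i \<partial>N)"
    and m2: "\<And>i j. (\<integral>h. h $ i * h $ j \<partial>M) = (\<integral>h. h $ i * h $ j \<partial>N)"
  shows "\<bar>avg M (softmax \<theta>) x - avg N (softmax \<theta>) x\<bar>
    \<le> \<theta>\<^sup>2 * ((\<integral>h. norm h ^ 3 \<partial>M) + (\<integral>h. norm h ^ 3 \<partial>N))"
proof -
  obtain p q where pq: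
    "\<And>h. \<bar>softmax \<theta> (x + h) - (softmax \<theta> x + (\<Sum>i\<in>UNIV. p i * h $ i) +
        (\<Sum>i\<in>UNIV. \<Sum>j\<in>UNIV. q i j * (h $ i * h $ j)))\<bar> \<le> \<theta>\<^sup>2 * norm h ^ 3"
    using softmax_taylor[OF \<theta>] by blast
  define T where "T h = softmax \<theta> x + (\<Sum>i\<in>UNIV. p i * h $ i) +
        (\<Sum>i\<in>UNIV. \<Sum>j\<in>UNIV. q i j * (h $ i * h $ j))" for h :: "real^'k"
  have *: "\<bar>avg K (softmax \<theta>) x - (\<integral>h. T h \<partial>K)\<bar> \<le> \<theta>\<^sup>2 * (\<integral>h. norm h ^ 3 \<partial>K)
     \<and> (\<integral>h. T h \<partial>K) = softmax \<theta> x + (\<Sum>i\<in>UNIV. p i * (\<integral>h. h $ i \<partial>K)) +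
        (\<Sum>i\<in>UNIV. \<Sum>j\<in>UNIV. q i j * (\<integral>h. h $ i * h $ j \<partial>K))"
    if K: "integrable_law K" and K3: "integrable K (\<lambda>h. norm h ^ 3)" for K
  proof -
    interpret prob_space K using K by (simp add: integrable_law_def)
    have [measurable_cong]: "sets K = sets borel" using K by (simp add: integrable_law_def)
    have [measurable]: "(\<lambda>h. h $ i) \<in> borel_measurable K" for i
      by (subst measurable_cong_sets[OF \<open>sets K = sets borel\<close> refl]) (rule borel_measurable_vec_nth)
    have i1: "integrable K (\<lambda>h. h $ i)" for i
    proof (rule Bochner_Integration.integrable_bound[of K norm])
      show "integrable K norm" using K by (simp add: integrable_law_def)
    qed (auto intro!: AE_I2 component_le_norm_cart)
    \<comment> \<open>Second moments are dominated by means of \<open>u^2 \<le> 1 + u^3\<close> for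
      nonnegative \<open>u\<close>.\<close>
    have i2: "integrable K (\<lambda>h. h $ i * h $ j)" for i j
    proof (rule Bochner_Integration.integrable_bound[of K "\<lambda>h. 1 + norm h ^ 3"])
      show "integrable K (\<lambda>h. 1 + norm h ^ 3)" using K3 by simp
      have "\<bar>h $ i * h $ j\<bar> \<le> 1 + norm h ^ 3" for h
      proof -
        have "\<bar>h $ i * h $ j\<bar> \<le> norm h ^ 2"
          unfolding abs_mult power2_eq_square by (intro mult_mono component_le_norm_cart) auto
        also have "norm h ^ 2 \<le> 1 + norm h ^ 3"
        proof (cases "norm h \<le> 1")
          case True
          then have "norm h ^ 2 \<le> 1" by (simp add: power_le_one)
          then show ?thesis by (simp add: add_increasing2)
        next
          case False
          then have "norm h ^ 2 \<le> norm h ^ 3" by (intro power_increasing) auto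
          then show ?thesis by simp
        qed
        finally show ?thesis .
      qed
      then show "AE h in K. norm (h $ i * h $ j) \<le> norm (1 + norm h ^ 3)"
        by (intro AE_I2) (simp add: abs_of_nonneg)
    qed measurable
    have iT: "integrable K T" unfolding T_def using i1 i2 by simp
    have iS: "integrable K (\<lambda>h. softmax \<theta> (x + h))"
      by (rule integrable_avg[OF K softmax_lipschitz[OF \<theta>]])
    have "\<bar>avg K (softmax \<theta>) x - (\<integral>h. T h \<partial>K)\<bar> = \<bar>\<integral>h. softmax \<theta> (x + h) - T h \<partial>K\<bar>"
      using iT iS by (simp add: avg_def)
    also have "\<dots> \<le> (\<integral>h. \<bar>softmax \<theta> (x + h) - T h\<bar> \<partial>K)"
      by (rule integral_abs_bound)
    also have "\<dots> \<le> (\<integral>h. \<theta>\<^sup>2 * norm h ^ 3 \<partial>K)"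
      using iT iS K3 pq[folded T_def] by (intro integral_mono) auto
    finally show ?thesis
      using i1 i2 by (simp add: T_def prob_space)
  qed
  have "(\<integral>h. T h \<partial>M) = (\<integral>h. T h \<partial>N)"
    using *[OF M M3] *[OF N N3] m1 m2 by simp
  then show ?thesis
    using *[OF M M3] *[OF N N3] by (simp add: abs_le_iff distrib_left)
qed

section \<open>Gaussian averages\<close>

abbreviation std_normal :: "real measure" where
  "std_normal \<equiv> density lborel std_normal_density"

lemma prob_space_std_normal: "prob_space std_normal"
  by (rule prob_space_normal_density) simp

lemma integrable_std_normal_abs_power: "integrable std_normal (\<lambda>x. \<bar>x\<bar> ^ m)"
  using integrable_std_normal_moment_abs[of m] by (subst integrable_density) auto

lemma integrable_std_normal_power: "integrable std_normal (\<lambda>x. x ^ m)"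
  using integrable_std_normal_moment[of m] by (subst integrable_density) auto

lemma std_normal_mean: "(\<integral>x. x \<partial>std_normal) = 0"
  using integral_std_normal_moment_odd[of 0] by (subst integral_density) auto

lemma std_normal_second_moment: "(\<integral>x. x\<^sup>2 \<partial>std_normal) = 1"
  using integral_std_normal_moment_even[of 1] by (subst integral_density) auto

lemma product_prob_space_std_normal: "product_prob_space (\<lambda>_. std_normal)"
  using prob_space_std_normal
  by (intro product_prob_spaceI)

lemma prob_space_std_gaussian: "prob_space (std_gaussian d)"
  unfolding std_gaussian_def
  by (intro prob_space_PiM prob_space_std_normal)

lemma measurable_std_gaussian_component [measurable]:
  "l < d \<Longrightarrow> (\<lambda>x. x l) \<in> borel_measurable (std_gaussian d)"
  unfolding std_gaussian_def by measurable

lemma std_gaussian_integrable_comp: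
  fixes g :: "real \<Rightarrow> real"
  assumes "l < d" "integrable std_normal g"
  shows "integrable (std_gaussian d) (\<lambda>x. g (x l))"
    and "(\<integral>x. g (x l) \<partial>std_gaussian d) = (\<integral>x. g x \<partial>std_normal)"
proof -
  interpret P: product_prob_space "\<lambda>_. std_normal" "{..<d}"
    by (rule product_prob_space_std_normal)
  have *: "distr (std_gaussian d) std_normal (\<lambda>x. x l) = std_normal"
    using assms(1) unfolding std_gaussian_def by (subst P.PiM_component) auto
  have [measurable]: "g \<in> borel_measurable borel" using borel_measurable_integrable[OF assms(2)] by simp
  have [measurable]: "(\<lambda>x. x l) \<in> std_gaussian d \<rightarrow>\<^sub>M std_normal"
    using assms(1) unfolding std_gaussian_def by (intro measurable_component_singleton) auto
  have "integrable (distr (std_gaussian d) std_normal (\<lambda>x. x l)) g"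
    using assms(2) by (simp add: *)
  then show "integrable (std_gaussian d) (\<lambda>x. g (x l))"
    using assms(1) by (subst (asm) integrable_distr_eq) auto
  have "(\<integral>x. g x \<partial>distr (std_gaussian d) std_normal (\<lambda>x. x l)) = (\<integral>x. g x \<partial>std_normal)"
    by (simp add: *)
  then show "(\<integral>x. g (x l) \<partial>std_gaussian d) = (\<integral>x. g x \<partial>std_normal)"
    using assms(1) by (subst (asm) integral_distr) auto
qed

lemma std_gaussian_second_moments:
  assumes "l < d" "m < d"
  shows "integrable (std_gaussian d) (\<lambda>x. x l * x m)"
    and "(\<integral>x. x l * x m \<partial>std_gaussian d) = (if l = m then 1 else 0)"
proof -
  interpret P: product_prob_space "\<lambda>_. std_normal" "{..<d}"
    by (rule product_prob_space_std_normal)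
  have "integrable (std_gaussian d) (\<lambda>x. x l * x m) \<and>
     (\<integral>x. x l * x m \<partial>std_gaussian d) = (if l = m then 1 else 0)"
  proof (cases "l = m")
    case True
    then show ?thesis
      using std_gaussian_integrable_comp[OF assms(1) integrable_std_normal_power[of 2]] std_normal_second_moment
      by (simp add: power2_eq_square)
  next
    case False
    \<comment> \<open>Padding with the constant 1 makes \<open>x l * x m\<close> a product over all
      coordinates. Its integral factorizes, and the factor at \<open>l\<close> has mean
      zero.\<close>
    define g where "g i = (if i = l \<or> i = m then (\<lambda>t. t) else (\<lambda>t. 1 :: real))" for i :: nat
    have int: "integrable std_normal (g i)" for i
      using integrable_std_normal_power[of 1] integrable_std_normal_power[of 0] by (auto simp: g_def)
    have "(\<Prod>i<d. g i (x i)) = x l * x m" for x :: "nat \<Rightarrow> real"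
    proof -
      have "(\<Prod>i<d. g i (x i)) = (\<Prod>i\<in>{l, m}. g i (x i))"
        using assms by (intro prod.mono_neutral_right) (auto simp: g_def)
      then show ?thesis using False by (simp add: g_def)
    qed
    moreover have "(\<Prod>i<d. \<integral>x. g i x \<partial>std_normal) = 0"
      using assms by (intro prod_zero bexI[of _ l]) (auto simp: g_def std_normal_mean)
    ultimately show ?thesis
      using P.product_integrable_prod[of "{..<d}" g] P.product_integral_prod[of "{..<d}" g] int False
      unfolding std_gaussian_def by simp
  qed
  then show "integrable (std_gaussian d) (\<lambda>x. x l * x m)"
    "(\<integral>x. x l * x m \<partial>std_gaussian d) = (if l = m then 1 else 0)" by auto
qed

section \<open>Gaussian laws on Euclidean space and their convolution\<close>

definition gauss :: "nat \<Rightarrow> (nat \<Rightarrow> 'a::euclidean_space) \<Rightarrow> 'a measure" where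
  "gauss d a = distr (std_gaussian d) borel (\<lambda>x. \<Sum>l<d. x l *\<^sub>R a l)"

text \<open>The one-dimensional building block: \<open>avg_gauss_Suc\<close> peels such factors off
  \<open>gauss\<close>, which reduces convolution identities to the real line.\<close>

definition line :: "'a::euclidean_space \<Rightarrow> 'a measure" where
  "line a = distr std_normal borel (\<lambda>t. t *\<^sub>R a)"

lemma measurable_gauss_map [measurable]:
  "(\<lambda>x. \<Sum>l<d. x l *\<^sub>R a l) \<in> borel_measurable (std_gaussian d)" for a :: "nat \<Rightarrow> 'a::euclidean_space"
  by measurable

lemma integrable_law_line: "integrable_law (line a)"
proof -
  interpret prob_space std_normal by (rule prob_space_std_normal)
  have "integrable std_normal (\<lambda>t. \<bar>t\<bar> ^ 1 * norm a)"
    by (intro integrable_mult_left integrable_std_normal_abs_power)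
  then show ?thesis
    unfolding integrable_law_def line_def
    by (auto simp: integrable_distr_eq intro!: prob_space_distr)
qed

lemma integrable_law_gauss: "integrable_law (gauss d a)"
proof -
  interpret prob_space "std_gaussian d" by (rule prob_space_std_gaussian)
  have "integrable (std_gaussian d) (\<lambda>x. norm (\<Sum>l<d. x l *\<^sub>R a l))"
    by (intro integrable_norm Bochner_Integration.integrable_sum integrable_scaleR_left impI)
      (simp add: integrable_std_gaussian_coordinate)
  then show ?thesis
    unfolding integrable_law_def gauss_def
    by (auto simp: integrable_distr_eq intro!: prob_space_distr)
qed

lemma avg_gauss:
  assumes "1-lipschitz_on UNIV F"
  shows "avg (gauss d a) F x = (\<integral>y. F (x + (\<Sum>l<d. y l *\<^sub>R a l)) \<partial>std_gaussian d)"
  using lipschitz_borel[OF assms]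
  unfolding avg_def gauss_def by (subst integral_distr) auto

lemma integrable_gauss:
  fixes F :: "'a::euclidean_space \<Rightarrow> real" and a :: "nat \<Rightarrow> 'a::euclidean_space"
  assumes "1-lipschitz_on UNIV F"
  shows "integrable (std_gaussian d) (\<lambda>y. F (x + (\<Sum>l<d. y l *\<^sub>R a l)))"
  using integrable_avg[OF integrable_law_gauss[of d a] assms, of x] lipschitz_borel[OF assms]
  unfolding gauss_def by (subst (asm) integrable_distr_eq) auto

lemma avg_line:
  assumes "1-lipschitz_on UNIV F"
  shows "avg (line a) F x = (\<integral>t. F (x + t *\<^sub>R a) \<partial>std_normal)"
  using lipschitz_borel[OF assms]
  unfolding avg_def line_def by (subst integral_distr) auto

lemma avg_gauss_0:
  assumes "1-lipschitz_on UNIV F"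
  shows "avg (gauss 0 a) F = F"
proof
  fix x
  interpret prob_space "std_gaussian 0" by (rule prob_space_std_gaussian)
  show "avg (gauss 0 a) F x = F x"
    by (simp add: avg_gauss[OF assms] prob_space)
qed

lemma avg_gauss_Suc:
  assumes F: "1-lipschitz_on UNIV F"
  shows "avg (gauss (Suc d) a) F = avg (gauss d a) (avg (line (a d)) F)"
proof
  fix x
  interpret P: product_prob_space "\<lambda>_. std_normal" "{..<d}"
    by (rule product_prob_space_std_normal)
  have ins: "{..<Suc d} = insert d {..<d}" by auto
  have int: "integrable (std_gaussian (Suc d)) (\<lambda>y. F (x + (\<Sum>l<Suc d. y l *\<^sub>R a l)))"
    by (rule integrable_gauss[OF F])
  have "(\<integral>y. F (x + (\<Sum>l<Suc d. y l *\<^sub>R a l)) \<partial>std_gaussian (Suc d)) =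
    (\<integral>y. (\<integral>t. F (x + (\<Sum>l<Suc d. (y(d := t)) l *\<^sub>R a l)) \<partial>std_normal) \<partial>std_gaussian d)"
    using int unfolding std_gaussian_def ins by (subst P.product_integral_insert) auto
  then show "avg (gauss (Suc d) a) F x = avg (gauss d a) (avg (line (a d)) F) x"
    by (simp add: avg_gauss[OF F] avg_line[OF F] avg_gauss[OF avg_lipschitz[OF integrable_law_line F]] add.assoc)
qed

text \<open>Independent summands use separate Gaussian coordinates, hence the concatenated list of
  directions. The second list is peeled off one line at a time.\<close>

lemma avg_gauss_add:
  assumes F: "1-lipschitz_on UNIV F"
  shows "avg (gauss d a) (avg (gauss e b) F) = avg (gauss (d + e) (\<lambda>l. if l < d then a l else b (l - d))) F"
  using F
proof (induction e arbitrary: F)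
  case 0
  have "gauss d (\<lambda>l. if l < d then a l else b (l - d)) = gauss d a"
    by (simp add: gauss_def)
  with 0 show ?case by (simp add: avg_gauss_0)
next
  case (Suc e)
  then show ?case
    by (simp add: avg_gauss_Suc avg_lipschitz integrable_law_line)
qed

text \<open>Moves the scale from the vector into the density, where \<open>avg_line_line\<close> can
  convolve centered normal densities.\<close>

lemma line_scale:
  fixes a :: "'a::euclidean_space"
  assumes s: "s > 0"
  shows "line (s *\<^sub>R a) = distr (density lborel (normal_density 0 s)) borel (\<lambda>t. t *\<^sub>R a)"
proof -
  interpret N: prob_space std_normal by (rule prob_space_std_normal)
  have "distr std_normal lborel (\<lambda>t. t) = std_normal"
    by (subst distr_cong[of _ std_normal lborel std_normal]) (auto simp: distr_id2)
  then have "distributed std_normal lborel (\<lambda>t. t) (normal_density 0 1)"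
    by (auto simp: distributed_def)
  from N.normal_density_affine[OF this, of s 0] s
  have "distributed std_normal lborel (\<lambda>t. s * t) (normal_density 0 s)" by simp
  then have *: "density lborel (normal_density 0 s) = distr std_normal lborel (\<lambda>t. s * t)"
    by (simp add: distributed_def)
  show ?thesis
    unfolding * line_def by (subst distr_distr) (auto simp: comp_def mult.commute)
qed

lemma avg_line_scale:
  assumes F: "1-lipschitz_on UNIV F" and s: "s > 0"
  shows "avg (line (s *\<^sub>R a)) F x = (\<integral>t. F (x + t *\<^sub>R a) \<partial>density lborel (normal_density 0 s))"
  using lipschitz_borel[OF F]
  unfolding avg_def line_scale[OF s] by (subst integral_distr) auto

text \<open>Along a fixed direction this is the convolution of two centered normal laws, whose
  variances add.\<close>

lemma avg_line_line:
  fixes a :: "'a::euclidean_space"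
  assumes F: "1-lipschitz_on UNIV F" and s: "s > 0" and t: "t > 0"
  shows "avg (line (s *\<^sub>R a)) (avg (line (t *\<^sub>R a)) F) = avg (line (sqrt (s\<^sup>2 + t\<^sup>2) *\<^sub>R a)) F"
proof
  fix x
  define N where "N u = density lborel (\<lambda>x. ennreal (normal_density 0 u x))" for u
  define r where "r = sqrt (s\<^sup>2 + t\<^sup>2)"
  have r: "r > 0" using s t by (simp add: r_def add_pos_pos)
  note [measurable] = lipschitz_borel[OF F]
  have N: "prob_space (N u)" if "u > 0" for u
    unfolding N_def by (rule prob_space_normal_density[OF that])
  have [measurable_cong]: "sets (N u) = sets borel" for u
    by (simp add: N_def)
  interpret S: prob_space "N s" by (rule N[OF s])
  interpret T: prob_space "N t" by (rule N[OF t])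
  interpret ST: pair_prob_space "N s" "N t" ..
  have conv: "N s \<star> N t = N r"
    unfolding N_def
    by (subst convolution_density)
      (use S.finite_measure_axioms T.finite_measure_axioms conv_normal_density_zero_mean[OF s t]
        in \<open>simp_all add: N_def r_def ennreal_mult'[symmetric]\<close>)
  let ?G = "\<lambda>u. F (x + u *\<^sub>R a)"
  have "integrable (line (r *\<^sub>R a)) (\<lambda>h. F (x + h))"
    by (rule integrable_avg[OF integrable_law_line F])
  then have "integrable (N r) ?G"
    unfolding line_scale[OF r] N_def[symmetric] by (subst (asm) integrable_distr_eq) (auto simp: N_def)
  then have int: "integrable (N s \<Otimes>\<^sub>M N t) (\<lambda>(u, v). ?G (u + v))"
    unfolding conv[symmetric] convolution_def
    by (subst (asm) integrable_distr_eq) (auto simp: case_prod_beta')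
  have "avg (line (s *\<^sub>R a)) (avg (line (t *\<^sub>R a)) F) x = (\<integral>u. (\<integral>v. ?G (u + v) \<partial>N t) \<partial>N s)"
    unfolding avg_line_scale[OF avg_lipschitz[OF integrable_law_line F] s] avg_line_scale[OF F t] N_def
    by (simp add: scaleR_add_left add.assoc)
  also have "\<dots> = (\<integral>p. (case p of (u, v) \<Rightarrow> ?G (u + v)) \<partial>(N s \<Otimes>\<^sub>M N t))"
    using ST.integral_fst'[OF int] by simp
  also have "\<dots> = (\<integral>w. ?G w \<partial>N r)"
    unfolding conv[symmetric] convolution_def
    by (subst integral_distr) (auto simp: case_prod_beta')
  also have "\<dots> = avg (line (r *\<^sub>R a)) F x"
    by (simp add: avg_line_scale[OF F r] N_def)
  finally show "avg (line (s *\<^sub>R a)) (avg (line (t *\<^sub>R a)) F) x = avg (line (sqrt (s\<^sup>2 + t\<^sup>2) *\<^sub>R a)) F x"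
    by (simp add: r_def)
qed

text \<open>Induction over the directions: commuting the averages brings the two factors along the
  same direction together, and \<open>avg_line_line\<close> merges them.\<close>

lemma avg_gauss_gauss:
  fixes a :: "nat \<Rightarrow> 'a::euclidean_space"
  assumes F: "1-lipschitz_on UNIV F" and s: "s > 0" and t: "t > 0"
  shows "avg (gauss d (\<lambda>l. s *\<^sub>R a l)) (avg (gauss d (\<lambda>l. t *\<^sub>R a l)) F) =
    avg (gauss d (\<lambda>l. sqrt (s\<^sup>2 + t\<^sup>2) *\<^sub>R a l)) F"
  using F
proof (induction d arbitrary: F)
  case 0
  then show ?case by (simp add: avg_gauss_0)
next
  case (Suc d)
  note F = Suc.prems
  have L: "1-lipschitz_on UNIV (avg (line (t *\<^sub>R a d)) F)"
    by (intro avg_lipschitz integrable_law_line F)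
  have "avg (gauss (Suc d) (\<lambda>l. s *\<^sub>R a l)) (avg (gauss (Suc d) (\<lambda>l. t *\<^sub>R a l)) F) =
    avg (gauss d (\<lambda>l. s *\<^sub>R a l)) (avg (line (s *\<^sub>R a d))
      (avg (gauss d (\<lambda>l. t *\<^sub>R a l)) (avg (line (t *\<^sub>R a d)) F)))"
    by (simp add: avg_gauss_Suc F avg_lipschitz integrable_law_gauss integrable_law_line)
  also have "\<dots> = avg (gauss d (\<lambda>l. s *\<^sub>R a l)) (avg (gauss d (\<lambda>l. t *\<^sub>R a l))
      (avg (line (s *\<^sub>R a d)) (avg (line (t *\<^sub>R a d)) F)))"
    by (subst avg_commute[OF integrable_law_line integrable_law_gauss L]) simp
  also have "\<dots> = avg (gauss d (\<lambda>l. sqrt (s\<^sup>2 + t\<^sup>2) *\<^sub>R a l)) (avg (line (sqrt (s\<^sup>2 + t\<^sup>2) *\<^sub>R a d)) F)"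
    unfolding avg_line_line[OF F s t] by (rule Suc.IH) (intro avg_lipschitz integrable_law_line F)
  also have "\<dots> = avg (gauss (Suc d) (\<lambda>l. sqrt (s\<^sup>2 + t\<^sup>2) *\<^sub>R a l)) F"
    by (simp add: avg_gauss_Suc F)
  finally show ?case .
qed

text \<open>Variances add under composition. Starting from one factor keeps both scales positive, as
  \<open>avg_gauss_gauss\<close> demands.\<close>

lemma avgs_gauss_power:
  assumes F: "1-lipschitz_on UNIV F" and s: "s > 0"
  shows "avgs (\<lambda>_. gauss d (\<lambda>l. s *\<^sub>R a l)) [0..<Suc m] F = avg (gauss d (\<lambda>l. (sqrt (Suc m) * s) *\<^sub>R a l)) F"
  using F
proof (induction m arbitrary: F)
  case (Suc m)
  have "(sqrt (Suc m) * s)\<^sup>2 + s\<^sup>2 = (sqrt (Suc (Suc m)) * s)\<^sup>2"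
    by (simp add: power_mult_distrib algebra_simps)
  then have *: "sqrt ((sqrt (Suc m) * s)\<^sup>2 + s\<^sup>2) = sqrt (Suc (Suc m)) * s"
    using s by (simp only: real_sqrt_abs) simp
  have "avgs (\<lambda>_. gauss d (\<lambda>l. s *\<^sub>R a l)) [0..<Suc (Suc m)] F =
    avgs (\<lambda>_. gauss d (\<lambda>l. s *\<^sub>R a l)) [0..<Suc m] (avg (gauss d (\<lambda>l. s *\<^sub>R a l)) F)"
    by simp
  also have "\<dots> = avg (gauss d (\<lambda>l. (sqrt (Suc m) * s) *\<^sub>R a l)) (avg (gauss d (\<lambda>l. s *\<^sub>R a l)) F)"
    by (rule Suc.IH) (intro avg_lipschitz integrable_law_gauss Suc.prems)
  also have "\<dots> = avg (gauss d (\<lambda>l. (sqrt (Suc (Suc m)) * s) *\<^sub>R a l)) F"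
    using s by (subst avg_gauss_gauss[OF Suc.prems]) (simp_all only: * of_nat_0_less_iff zero_less_Suc real_sqrt_gt_zero mult_pos_pos)
  finally show ?case .
qed simp

section \<open>Gaussian moments; the average of the soft maximum depends only on the
  covariance\<close>

definition gauss_third :: "nat \<Rightarrow> real" where
  "gauss_third d = (\<integral>x. (\<Sum>l<d. \<bar>x l\<bar> ^ 3) \<partial>std_gaussian d)"

lemma gauss_third_nonneg: "gauss_third d \<ge> 0"
  unfolding gauss_third_def by (intro integral_nonneg_AE AE_I2 sum_nonneg) auto

text \<open>The largest coefficient in absolute value can be taken out of the sum, and its cube is
  one of the nonnegative summands on the right.\<close>

lemma norm_sum_scaleR_cube_le:
  fixes a :: "nat \<Rightarrow> 'a::real_normed_vector"
  shows "norm (\<Sum>l<d. x l *\<^sub>R a l) ^ 3 \<le> (\<Sum>l<d. \<bar>x l\<bar> ^ 3) * (\<Sum>l<d. norm (a l)) ^ 3"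
proof (cases "d = 0")
  case False
  define m where "m = Max ((\<lambda>l. \<bar>x l\<bar>) ` {..<d})"
  have "m \<in> (\<lambda>l. \<bar>x l\<bar>) ` {..<d}" unfolding m_def using False by (intro Max_in) auto
  then obtain l where l: "l < d" "m = \<bar>x l\<bar>" by auto
  have m: "\<bar>x i\<bar> \<le> m" if "i < d" for i
    unfolding m_def using that by (intro Max_ge) auto
  have "norm (\<Sum>l<d. x l *\<^sub>R a l) \<le> (\<Sum>l<d. m * norm (a l))"
    by (intro sum_norm_le) (auto intro: mult_right_mono m)
  then have "norm (\<Sum>l<d. x l *\<^sub>R a l) ^ 3 \<le> (m * (\<Sum>l<d. norm (a l))) ^ 3"
    by (intro power_mono) (auto simp: sum_distrib_left)
  also have "\<dots> = \<bar>x l\<bar> ^ 3 * (\<Sum>l<d. norm (a l)) ^ 3"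
    by (simp add: l power_mult_distrib)
  also have "\<dots> \<le> (\<Sum>l<d. \<bar>x l\<bar> ^ 3) * (\<Sum>l<d. norm (a l)) ^ 3"
    using l by (intro mult_right_mono member_le_sum zero_le_power sum_nonneg) auto
  finally show ?thesis .
qed simp

lemma gauss_third_moment:
  fixes a :: "nat \<Rightarrow> 'a::euclidean_space"
  shows "integrable (gauss d a) (\<lambda>h. norm h ^ 3)"
    and "(\<integral>h. norm h ^ 3 \<partial>gauss d a) \<le> gauss_third d * (\<Sum>l<d. norm (a l)) ^ 3"
proof -
  have int: "integrable (std_gaussian d) (\<lambda>x. (\<Sum>l<d. \<bar>x l\<bar> ^ 3) * (\<Sum>l<d. norm (a l)) ^ 3)"
    by (intro integrable_mult_left Bochner_Integration.integrable_sum
        std_gaussian_integrable_comp integrable_std_normal_abs_power) auto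
  then have int2: "integrable (std_gaussian d) (\<lambda>x. norm (\<Sum>l<d. x l *\<^sub>R a l) ^ 3)"
    by (rule Bochner_Integration.integrable_bound)
      (auto intro!: AE_I2 order_trans[OF norm_sum_scaleR_cube_le] simp: abs_mult mult_mono sum_nonneg)
  then show "integrable (gauss d a) (\<lambda>h. norm h ^ 3)"
    unfolding gauss_def by (subst integrable_distr_eq) auto
  have "(\<integral>h. norm h ^ 3 \<partial>gauss d a) = (\<integral>x. norm (\<Sum>l<d. x l *\<^sub>R a l) ^ 3 \<partial>std_gaussian d)"
    unfolding gauss_def by (subst integral_distr) auto
  also have "\<dots> \<le> (\<integral>x. (\<Sum>l<d. \<bar>x l\<bar> ^ 3) * (\<Sum>l<d. norm (a l)) ^ 3 \<partial>std_gaussian d)"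
    using int int2 norm_sum_scaleR_cube_le by (intro integral_mono) auto
  finally show "(\<integral>h. norm h ^ 3 \<partial>gauss d a) \<le> gauss_third d * (\<Sum>l<d. norm (a l)) ^ 3"
    by (simp add: gauss_third_def)
qed

lemma gauss_mean:
  fixes a :: "nat \<Rightarrow> real^'k::finite"
  shows "(\<integral>h. h $ i \<partial>gauss d a) = 0"
proof -
  have "(\<integral>h. h $ i \<partial>gauss d a) = (\<integral>x. (\<Sum>l<d. x l * a l $ i) \<partial>std_gaussian d)"
    unfolding gauss_def
    by (subst integral_distr) (auto simp: sum_component intro: borel_measurable_vec_nth)
  also have "\<dots> = (\<Sum>l<d. (\<integral>x. x l * a l $ i \<partial>std_gaussian d))"
    by (intro Bochner_Integration.integral_sum integrable_mult_left)
      (simp add: integrable_std_gaussian_coordinate)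
  also have "\<dots> = 0"
    using std_gaussian_integrable_comp(2)[OF _ integrable_std_normal_power[of 1], of _ d] std_normal_mean
    by simp
  finally show ?thesis .
qed

lemma gauss_second_moment:
  fixes a :: "nat \<Rightarrow> real^'k::finite"
  shows "(\<integral>h. h $ i * h $ j \<partial>gauss d a) = (\<Sum>l<d. a l $ i * a l $ j)"
proof -
  have "(\<integral>h. h $ i * h $ j \<partial>gauss d a) =
      (\<integral>x. (\<Sum>l<d. \<Sum>m<d. (x l * x m) * (a l $ i * a m $ j)) \<partial>std_gaussian d)"
    unfolding gauss_def
    by (subst integral_distr)
      (auto simp: sum_product mult_ac intro: borel_measurable_vec_nth intro!: borel_measurable_times)
  also have "\<dots> = (\<Sum>l<d. \<integral>x. (\<Sum>m<d. (x l * x m) * (a l $ i * a m $ j)) \<partial>std_gaussian d)"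
    by (intro Bochner_Integration.integral_sum Bochner_Integration.integrable_sum integrable_mult_left
        std_gaussian_second_moments) simp_all
  also have "\<dots> = (\<Sum>l<d. \<Sum>m<d. (\<integral>x. (x l * x m) * (a l $ i * a m $ j) \<partial>std_gaussian d))"
    by (intro sum.cong refl Bochner_Integration.integral_sum integrable_mult_left
        std_gaussian_second_moments) simp_all
  also have "\<dots> = (\<Sum>l<d. \<Sum>m<d. (if l = m then a l $ i * a m $ j else 0))"
    by (intro sum.cong refl) (auto simp: std_gaussian_second_moments)
  finally show ?thesis by simp
qed

text \<open>Both sides are semigroups in the variance: each is an \<open>m\<close>-fold composition of its version
  scaled by \<open>1 / sqrt m\<close>, and the scaled versions differ by \<open>O(m powr (-3/2))\<close> as their first two
  moments agree.\<close>

lemma avg_gauss_softmax_eq: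
  fixes a b :: "nat \<Rightarrow> real^'k::finite"
  assumes \<theta>: "\<theta> > 0"
    and cov: "\<And>i j. (\<Sum>l<d. a l $ i * a l $ j) = (\<Sum>l<e. b l $ i * b l $ j)"
  shows "avg (gauss d a) (softmax \<theta>) x = avg (gauss e b) (softmax \<theta>) x"
proof -
  note F = softmax_lipschitz[OF \<theta>]
  define K where "K = \<theta>\<^sup>2 * (gauss_third d * (\<Sum>l<d. norm (a l)) ^ 3 + gauss_third e * (\<Sum>l<e. norm (b l)) ^ 3)"
  let ?\<Delta> = "\<bar>avg (gauss d a) (softmax \<theta>) x - avg (gauss e b) (softmax \<theta>) x\<bar>"
  have "?\<Delta> \<le> K / sqrt (Suc m)" for m
  proof -
    define s where "s = 1 / sqrt (Suc m)"
    have s: "s > 0" "sqrt (Suc m) * s = 1" "Suc m * s ^ 2 = 1"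
      by (simp_all add: s_def power_divide)
    let ?a = "\<lambda>l. s *\<^sub>R a l" and ?b = "\<lambda>l. s *\<^sub>R b l"
    have third: "(\<integral>h. norm h ^ 3 \<partial>gauss q (\<lambda>l. s *\<^sub>R c l)) \<le> s ^ 3 * (gauss_third q * (\<Sum>l<q. norm (c l)) ^ 3)"
      for q and c :: "nat \<Rightarrow> real^'k"
    proof -
      have "(\<Sum>l<q. norm (s *\<^sub>R c l)) = s * (\<Sum>l<q. norm (c l))"
        using s by (simp add: sum_distrib_left)
      then show ?thesis
        using gauss_third_moment(2)[of q "\<lambda>l. s *\<^sub>R c l"] by (simp add: power_mult_distrib mult_ac)
    qed
    have "\<bar>avg (gauss d ?a) (softmax \<theta>) y - avg (gauss e ?b) (softmax \<theta>) y\<bar> \<le> s ^ 3 * K" for y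
    proof -
      have "(\<Sum>l<q. (s *\<^sub>R c l) $ i * (s *\<^sub>R c l) $ j) = s\<^sup>2 * (\<Sum>l<q. c l $ i * c l $ j)"
        for q i j and c :: "nat \<Rightarrow> real^'k"
        by (simp add: sum_distrib_left power2_eq_square mult_ac)
      then have "\<bar>avg (gauss d ?a) (softmax \<theta>) y - avg (gauss e ?b) (softmax \<theta>) y\<bar>
          \<le> \<theta>\<^sup>2 * ((\<integral>h. norm h ^ 3 \<partial>gauss d ?a) + (\<integral>h. norm h ^ 3 \<partial>gauss e ?b))"
        by (intro avg_softmax_diff_le integrable_law_gauss gauss_third_moment \<theta>)
          (simp_all only: gauss_mean gauss_second_moment cov)
      also have "\<dots> \<le> \<theta>\<^sup>2 * (s ^ 3 * (gauss_third d * (\<Sum>l<d. norm (a l)) ^ 3)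
          + s ^ 3 * (gauss_third e * (\<Sum>l<e. norm (b l)) ^ 3))"
        by (intro mult_left_mono add_mono third) auto
      also have "\<dots> = s ^ 3 * K" by (simp add: K_def algebra_simps)
      finally show ?thesis .
    qed
    then have "\<bar>avgs (\<lambda>_. gauss d ?a) [0..<Suc m] (softmax \<theta>) x - avgs (\<lambda>_. gauss e ?b) [0..<Suc m] (softmax \<theta>) x\<bar>
      \<le> (\<Sum>j\<leftarrow>[0..<Suc m]. s ^ 3 * K)"
      by (intro avgs_replace integrable_law_gauss F)
    \<comment> \<open>Of the \<open>Suc m\<close> errors \<open>s ^ 3 * K\<close>, the identity
      \<open>Suc m * s ^ 2 = 1\<close> leaves only \<open>s * K\<close>, which tends to
      zero.\<close>
    also have "(\<Sum>j\<leftarrow>[0..<Suc m]. s ^ 3 * K) = Suc m * s ^ 2 * (s * K)"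
      by (simp add: sum_list_triv power2_eq_square power3_eq_cube del: upt_Suc)
    finally show ?thesis
      unfolding avgs_gauss_power[OF F s(1)] s by (simp add: s_def)
  qed
  moreover have "(\<lambda>m. K / sqrt (Suc m)) \<longlonglongrightarrow> 0"
    by real_asymp
  ultimately have "?\<Delta> \<le> 0"
    by (intro LIMSEQ_le_const) auto
  then show ?thesis by simp
qed

section \<open>Gram vectors and the maximum of a Gaussian process\<close>

text \<open>Cholesky factorization by induction on the index set. Completing the square in
  coordinate \<open>e\<close> leaves a form on \<open>I\<close>, the Schur complement, which is
  again positive semidefinite; the eliminated coordinate contributes one new column.\<close>

lemma psd_factorization:
  fixes Q :: "'i \<Rightarrow> 'i \<Rightarrow> real"
  assumes "finite I" and "\<And>i j. Q i j = Q j i"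
    and "\<And>x. 0 \<le> (\<Sum>i\<in>I. \<Sum>j\<in>I. x i * x j * Q i j)"
  shows "\<exists>c. \<forall>i\<in>I. \<forall>j\<in>I. Q i j = (\<Sum>l<card I. c i l * c j l)"
  using assms
proof (induction I arbitrary: Q)
  case (insert e I)
  note sym = insert.prems(1)
  define q where "q = Q e e"
  have expand: "(\<Sum>i\<in>insert e I. \<Sum>j\<in>insert e I. x i * x j * Q i j) =
      (\<Sum>i\<in>I. \<Sum>j\<in>I. x i * x j * Q i j) + 2 * x e * (\<Sum>i\<in>I. x i * Q i e) + (x e)\<^sup>2 * q" for x
  proof -
    have "(\<Sum>j\<in>I. x e * x j * Q e j) = x e * (\<Sum>i\<in>I. x i * Q i e)"
      by (simp add: sum_distrib_left sym[of e] mult_ac)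
    moreover have "(\<Sum>i\<in>I. x i * x e * Q i e) = x e * (\<Sum>i\<in>I. x i * Q i e)"
      by (simp add: sum_distrib_left mult_ac)
    ultimately show ?thesis
      using insert.hyps by (simp add: sum.distrib q_def power2_eq_square algebra_simps)
  qed
  have q: "q \<ge> 0"
  proof -
    have "(\<Sum>i\<in>I. \<Sum>j\<in>I. (if i = e then 1 else 0) * (if j = e then 1 else 0) * Q i j) = 0"
      "(\<Sum>i\<in>I. (if i = e then 1 else 0) * Q i e) = 0"
      using insert.hyps by (auto intro!: sum.neutral)
    then show ?thesis
      using insert.prems(2)[of "\<lambda>i. if i = e then 1 else 0"] unfolding expand by simp
  qed
  have zero: "Q i e = 0" if "q = 0" "i \<in> I" for i
  proof (rule ccontr)
    assume ne: "Q i e \<noteq> 0"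
    \<comment> \<open>With coordinate \<open>i\<close> equal to 1 the form takes the value
      \<open>Q i i + 2 * x e * Q i e\<close>, and this choice at \<open>e\<close> makes it
      -1.\<close>
    define x where "x j = (if j = e then - (Q i i + 1) / (2 * Q i e) else if j = i then 1 else 0)" for j
    have io: "i \<noteq> e" using that insert.hyps by auto
    have "(\<Sum>k\<in>I. \<Sum>j\<in>I. x k * x j * Q k j) = (\<Sum>k\<in>I. \<Sum>j\<in>I. if k = i then if j = i then Q i i else 0 else 0)"
      using insert.hyps by (intro sum.cong refl) (auto simp: x_def)
    also have "\<dots> = (\<Sum>k\<in>I. if k = i then (\<Sum>j\<in>I. if j = i then Q i i else 0) else 0)"
      by (intro sum.cong refl) auto
    also have "\<dots> = Q i i" using that insert.hyps by simp
    finally have 1: "(\<Sum>k\<in>I. \<Sum>j\<in>I. x k * x j * Q k j) = Q i i" .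
    have "(\<Sum>k\<in>I. x k * Q k e) = (\<Sum>k\<in>I. if k = i then Q i e else 0)"
      using insert.hyps by (intro sum.cong refl) (auto simp: x_def)
    also have "\<dots> = Q i e" using that insert.hyps by simp
    finally have 2: "(\<Sum>k\<in>I. x k * Q k e) = Q i e" .
    have "2 * x e * Q i e = - (Q i i + 1)"
      using ne by (simp add: x_def)
    then have "(\<Sum>k\<in>insert e I. \<Sum>j\<in>insert e I. x k * x j * Q k j) = - 1"
      unfolding expand 1 2 using \<open>q = 0\<close> by simp
    with insert.prems(2)[of x] show False by simp
  qed
  \<comment> \<open>The Schur complement. For \<open>q = 0\<close> division by zero makes the
    correction vanish, so \<open>Q'\<close> is then \<open>Q\<close> itself.\<close>
  define Q' where "Q' i j = Q i j - Q i e * Q j e / q" for i j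
  have "0 \<le> (\<Sum>i\<in>I. \<Sum>j\<in>I. x i * x j * Q' i j)" for x
  proof -
    define b where "b = (\<Sum>i\<in>I. x i * Q i e)"
    \<comment> \<open>For positive \<open>q\<close> the value at \<open>e\<close> minimises the full
      form with the other coordinates fixed; for \<open>q = 0\<close> it is 0.\<close>
    define x' where "x' = x(e := - b / q)"
    have "(\<Sum>i\<in>I. \<Sum>j\<in>I. x i * x j * Q' i j) = (\<Sum>i\<in>I. \<Sum>j\<in>I. x i * x j * Q i j) - b\<^sup>2 / q"
      unfolding Q'_def b_def power2_eq_square sum_product
      by (simp add: right_diff_distrib sum_subtractf sum_divide_distrib mult_ac)
    also have "\<dots> = (\<Sum>i\<in>insert e I. \<Sum>j\<in>insert e I. x' i * x' j * Q i j)"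
    proof -
      have "(\<Sum>i\<in>I. \<Sum>j\<in>I. x' i * x' j * Q i j) = (\<Sum>i\<in>I. \<Sum>j\<in>I. x i * x j * Q i j)"
        "(\<Sum>i\<in>I. x' i * Q i e) = b"
        using insert.hyps unfolding b_def by (auto intro!: sum.cong simp: x'_def)
      then show ?thesis
        unfolding expand by (cases "q = 0") (simp_all add: x'_def field_simps power2_eq_square)
    qed
    finally show ?thesis using insert.prems(2) by simp
  qed
  moreover have "Q' i j = Q' j i" for i j
    by (simp add: Q'_def sym[of i j] mult.commute)
  ultimately obtain c where c: "\<forall>i\<in>I. \<forall>j\<in>I. Q' i j = (\<Sum>l<card I. c i l * c j l)"
    using insert.IH[of Q'] by blast
  \<comment> \<open>Row \<open>e\<close> gets zeros in the old columns. The new column, numbered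
    \<open>card I\<close>, restores the rank-one term subtracted in \<open>Q'\<close>.\<close>
  define c' where "c' i l = (if l = card I then Q i e / sqrt q else if i = e then 0 else c i l)" for i l
  have "Q i j = (\<Sum>l<card (insert e I). c' i l * c' j l)" if ij: "i \<in> insert e I" "j \<in> insert e I" for i j
  proof -
    have "(\<Sum>l<card (insert e I). c' i l * c' j l) = (\<Sum>l<card I. c' i l * c' j l) + Q i e * Q j e / q"
      using insert.hyps q by (simp add: c'_def power2_eq_square[symmetric])
    also have "(\<Sum>l<card I. c' i l * c' j l) = (if i = e \<or> j = e then 0 else Q' i j)"
      using ij c by (auto simp: c'_def)
    also have "\<dots> + Q i e * Q j e / q = Q i j"
    proof (cases "q = 0")
      case True
      have "Q k e = 0 \<and> Q e k = 0" if "k \<in> insert e I" for k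
        using that zero[OF True, of k] sym[of e k] True by (auto simp: q_def)
      from this[OF ij(1)] this[OF ij(2)] show ?thesis
        by (auto simp: Q'_def True)
    next
      case False
      then show ?thesis
        using sym[of e j] by (auto simp: Q'_def q_def[symmetric])
    qed
    finally show ?thesis by simp
  qed
  then show ?case by blast
qed simp

text \<open>Vectors summing to zero span at most \<open>CARD('k) - 1\<close> dimensions.\<close>

lemma gram_realization:
  fixes z :: "'k::finite \<Rightarrow> 's \<Rightarrow> real"
  assumes "finite S" and z0: "\<And>s. s \<in> S \<Longrightarrow> (\<Sum>i\<in>UNIV. z i s) = 0"
  obtains \<zeta> :: "'k \<Rightarrow> nat \<Rightarrow> real"
  where "\<And>i j. (\<Sum>l<CARD('k) - 1. \<zeta> i l * \<zeta> j l) = (\<Sum>s\<in>S. z i s * z j s)"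
proof -
  obtain e :: 'k where True by simp
  define I where "I = UNIV - {e}"
  define d where "d = CARD('k) - 1"
  have d: "card I = d" by (simp add: I_def d_def)
  define Q where "Q i j = (\<Sum>s\<in>S. z i s * z j s)" for i j
  have "\<exists>c. \<forall>i\<in>I. \<forall>j\<in>I. Q i j = (\<Sum>l<card I. c i l * c j l)"
  proof (rule psd_factorization)
    fix x :: "'k \<Rightarrow> real"
    have "(\<Sum>i\<in>I. \<Sum>j\<in>I. x i * x j * Q i j) = (\<Sum>i\<in>I. \<Sum>j\<in>I. \<Sum>s\<in>S. (x i * z i s) * (x j * z j s))"
      unfolding Q_def sum_distrib_left by (intro sum.cong refl) (simp add: mult_ac)
    also have "\<dots> = (\<Sum>i\<in>I. \<Sum>s\<in>S. \<Sum>j\<in>I. (x i * z i s) * (x j * z j s))"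
      by (intro sum.cong refl sum.swap)
    also have "\<dots> = (\<Sum>s\<in>S. \<Sum>i\<in>I. \<Sum>j\<in>I. (x i * z i s) * (x j * z j s))"
      by (rule sum.swap)
    also have "\<dots> = (\<Sum>s\<in>S. (\<Sum>i\<in>I. x i * z i s)\<^sup>2)"
      by (simp add: power2_eq_square sum_product)
    finally show "0 \<le> (\<Sum>i\<in>I. \<Sum>j\<in>I. x i * x j * Q i j)"
      by (simp add: sum_nonneg)
  qed (auto simp: I_def Q_def mult.commute)
  then obtain c where c: "Q i j = (\<Sum>l<d. c i l * c j l)" if "i \<in> I" "j \<in> I" for i j
    unfolding d by blast
  \<comment> \<open>The Gram matrix was factored on the \<open>d\<close> indices other than
    \<open>e\<close>. Vector \<open>e\<close> is restored by making the new vectors sum to zero as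
    well; Gram entries that involve \<open>e\<close> then agree by bilinearity.\<close>
  define \<zeta> where "\<zeta> i l = (if i = e then - (\<Sum>p\<in>I. c p l) else c i l)" for i l
  have zo: "z e s = - (\<Sum>p\<in>I. z p s)" if "s \<in> S" for s
    using z0[OF that] unfolding I_def by (subst (asm) sum.remove[of _ e]) auto
  have Qo: "Q e j = - (\<Sum>p\<in>I. Q p j)" for j
    unfolding Q_def by (subst sum.swap) (simp add: zo sum_negf sum_distrib_right)
  have 1: "Q i j = (\<Sum>l<d. \<zeta> i l * \<zeta> j l)" if j: "j \<in> I" for i j
  proof (cases "i = e")
    case True
    have "Q e j = - (\<Sum>p\<in>I. \<Sum>l<d. c p l * c j l)"
      unfolding Qo using j by (simp add: c)
    also have "\<dots> = (\<Sum>l<d. \<zeta> e l * \<zeta> j l)"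
      using j by (subst sum.swap) (auto simp: \<zeta>_def I_def sum_negf sum_distrib_right)
    finally show ?thesis using True by simp
  next
    case False
    then show ?thesis using j by (subst c) (auto simp: \<zeta>_def I_def)
  qed
  have "Q i j = (\<Sum>l<d. \<zeta> i l * \<zeta> j l)" for i j
  proof (cases "j = e")
    case True
    have "Q i e = Q e i" by (simp add: Q_def mult.commute)
    also have "\<dots> = - (\<Sum>p\<in>I. Q p i)" by (rule Qo)
    also have "\<dots> = - (\<Sum>p\<in>I. Q i p)" by (simp add: Q_def mult.commute)
    also have "\<dots> = - (\<Sum>p\<in>I. \<Sum>l<d. \<zeta> i l * \<zeta> p l)" by (simp add: 1)
    also have "\<dots> = (\<Sum>l<d. \<zeta> i l * - (\<Sum>p\<in>I. \<zeta> p l))"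
      by (subst sum.swap) (simp add: sum_negf sum_distrib_left)
    also have "\<dots> = (\<Sum>l<d. \<zeta> i l * \<zeta> e l)"
      by (intro sum.cong refl) (auto simp: \<zeta>_def I_def intro!: sum.cong)
    finally show ?thesis using True by simp
  next
    case False
    then show ?thesis by (intro 1) (simp add: I_def)
  qed
  then show ?thesis
    by (intro that[of \<zeta>]) (simp add: Q_def d_def)
qed

section \<open>The partition by the maximising index and the comparison with
  \<open>C_max\<close>\<close>

lemma argmax_partition:
  fixes y :: "'k::finite \<Rightarrow> nat \<Rightarrow> real"
  obtains A where "A \<in> measurable_partitions d"
    and "\<And>i j x. x \<in> A i \<Longrightarrow> (\<Sum>l<d. x l * y j l) \<le> (\<Sum>l<d. x l * y i l)"
proof -
  define u where "u i x = (\<Sum>l<d. x l * y i l)" for i and x :: "nat \<Rightarrow> real"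
  have [measurable]: "u i \<in> borel_measurable (std_gaussian d)" for i
    unfolding u_def by measurable
  have [measurable]: "Measurable.pred (std_gaussian d) (\<lambda>x. u j x \<le> u i x)"
    "Measurable.pred (std_gaussian d) (\<lambda>x. u j x < u i x)" for i j
    unfolding pred_def by (rule borel_measurable_le borel_measurable_less; simp)+
  \<comment> \<open>An injective numbering breaks ties: each point goes to the maximising index with
    the least number, so the parts are disjoint at every point.\<close>
  obtain h :: "'k \<Rightarrow> nat" where h: "inj h"
    using finite_imp_inj_to_nat_seg[of "UNIV :: 'k set"] by auto
  define A where "A i = {x \<in> space (std_gaussian d). (\<forall>j. u j x \<le> u i x) \<and> (\<forall>j. h j < h i \<longrightarrow> u j x < u i x)}" for i
  have "A i \<in> sets (std_gaussian d)" for i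
    unfolding A_def by measurable
  moreover have "disjoint_family A"
    unfolding disjoint_family_on_def
  proof (intro ballI impI equals0I)
    fix i j x assume "i \<noteq> j" and x: "x \<in> A i \<inter> A j"
    then have "h i < h j \<or> h j < h i" using h by (metis injD nat_neq_iff)
    with x show False unfolding A_def by (auto simp: not_less[symmetric])
  qed
  moreover have "(\<Union>i. A i) = space (std_gaussian d)"
  proof (intro equalityI subsetI)
    fix x assume x: "x \<in> space (std_gaussian d)"
    define K where "K = {i. \<forall>j. u j x \<le> u i x}"
    have "K \<noteq> {}"
    proof -
      have "Max (range (\<lambda>i. u i x)) \<in> range (\<lambda>i. u i x)" by (intro Max_in) auto
      then obtain i where "Max (range (\<lambda>i. u i x)) = u i x" by blast
      have "u j x \<le> u i x" for j
        unfolding \<open>Max _ = u i x\<close>[symmetric] by (rule Max_ge) auto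
      then show ?thesis by (auto simp: K_def)
    qed
    then obtain i where i: "i \<in> K" "\<And>j. j \<in> K \<Longrightarrow> h i \<le> h j"
      using ex_has_least_nat[of "\<lambda>i. i \<in> K" _ h] by auto
    have "u j x < u i x" if "h j < h i" for j
    proof (rule ccontr)
      assume "\<not> u j x < u i x"
      then have "j \<in> K" using i(1) unfolding K_def by (auto intro: order_trans)
      then show False using i(2) that by force
    qed
    then have "x \<in> A i" using i(1) x by (simp add: A_def K_def)
    then show "x \<in> (\<Union>i. A i)" by auto
  qed (auto simp: A_def)
  ultimately show ?thesis
    by (intro that[of A]) (auto simp: measurable_partitions_def A_def u_def)
qed

text \<open>The vectors \<open>y p\<close> enter the right-hand side through their Gram matrix
  alone. Hence such sums keep their value when \<open>z\<close> is exchanged for its realization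
  \<zeta> in fewer dimensions.\<close>

lemma sum_bilinear:
  fixes \<alpha> \<beta> :: "'i \<Rightarrow> real"
  shows "(\<Sum>s\<in>S. (\<Sum>p\<in>I. \<alpha> p * y p s) * (\<Sum>q\<in>I. \<beta> q * y q s)) =
    (\<Sum>p\<in>I. \<Sum>q\<in>I. \<alpha> p * \<beta> q * (\<Sum>s\<in>S. y p s * y q s))"
proof -
  have "(\<Sum>s\<in>S. (\<Sum>p\<in>I. \<alpha> p * y p s) * (\<Sum>q\<in>I. \<beta> q * y q s)) =
      (\<Sum>s\<in>S. \<Sum>p\<in>I. \<Sum>q\<in>I. \<alpha> p * \<beta> q * (y p s * y q s))"
    unfolding sum_product by (intro sum.cong refl) (simp add: mult_ac)
  also have "\<dots> = (\<Sum>p\<in>I. \<Sum>s\<in>S. \<Sum>q\<in>I. \<alpha> p * \<beta> q * (y p s * y q s))"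
    by (rule sum.swap)
  also have "\<dots> = (\<Sum>p\<in>I. \<Sum>q\<in>I. \<Sum>s\<in>S. \<alpha> p * \<beta> q * (y p s * y q s))"
    by (intro sum.cong refl sum.swap)
  finally show ?thesis by (simp add: sum_distrib_left)
qed

text \<open>Once \<open>B\<close> is the Gram matrix of \<open>v\<close>, both the objective and the
  value of a partition have the form on the left, so each becomes the squared Frobenius norm of a
  matrix with columns in the span of \<open>v\<close>.\<close>

lemma sum_gram_norm:
  fixes v :: "'i \<Rightarrow> real^'k"
  shows "(\<Sum>p\<in>I. \<Sum>q\<in>I. (v p \<bullet> v q) * (\<Sum>s\<in>S. y p s * y q s)) = (\<Sum>s\<in>S. (norm (\<Sum>p\<in>I. y p s *\<^sub>R v p))\<^sup>2)"
proof -
  have "(\<Sum>s\<in>S. (norm (\<Sum>p\<in>I. y p s *\<^sub>R v p))\<^sup>2) =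
      (\<Sum>s\<in>S. \<Sum>i\<in>UNIV. (\<Sum>p\<in>I. (v p $ i) * y p s) * (\<Sum>q\<in>I. (v q $ i) * y q s))"
    unfolding power2_norm_eq_inner inner_vec_def by (simp add: sum_component mult.commute)
  also have "\<dots> = (\<Sum>i\<in>UNIV. \<Sum>p\<in>I. \<Sum>q\<in>I. (v p $ i) * (v q $ i) * (\<Sum>s\<in>S. y p s * y q s))"
    by (subst sum.swap) (simp only: sum_bilinear)
  also have "\<dots> = (\<Sum>p\<in>I. \<Sum>i\<in>UNIV. \<Sum>q\<in>I. (v p $ i) * (v q $ i) * (\<Sum>s\<in>S. y p s * y q s))"
    by (rule sum.swap)
  also have "\<dots> = (\<Sum>p\<in>I. \<Sum>q\<in>I. \<Sum>i\<in>UNIV. (v p $ i) * (v q $ i) * (\<Sum>s\<in>S. y p s * y q s))"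
    by (intro sum.cong refl sum.swap)
  finally show ?thesis by (simp add: inner_vec_def sum_distrib_right)
qed

lemma partition_value_eq:
  fixes B :: "real^'k^'k" and v :: "'k::finite \<Rightarrow> real^'k"
  assumes "\<And>i j. B $ i $ j = v i \<bullet> v j"
  shows "partition_value B d A = (\<Sum>l<d. (norm (\<Sum>i\<in>UNIV. gaussian_moment d (A i) l *\<^sub>R v i))\<^sup>2)"
  unfolding partition_value_def assms by (rule sum_gram_norm)

lemma gaussian_max_le_C_max:
  fixes B :: "real^'k^'k" and v :: "'k::finite \<Rightarrow> real^'k" and m :: "nat \<Rightarrow> real^'k"
  defines "d \<equiv> CARD('k) - 1"
  assumes B: "\<And>i j. B $ i $ j = v i \<bullet> v j" and m: "(\<Sum>l<d. (norm (m l))\<^sup>2) \<le> 1"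
  shows "integrable (std_gaussian d) (\<lambda>x. MAX i. \<Sum>l<d. x l * (v i \<bullet> m l))"
    and "(\<integral>x. (MAX i. \<Sum>l<d. x l * (v i \<bullet> m l)) \<partial>std_gaussian d) \<le> sqrt (C_max B)"
proof -
  define u where "u i x = (\<Sum>l<d. x l * (v i \<bullet> m l))" for i and x :: "nat \<Rightarrow> real"
  have int_u: "integrable (std_gaussian d) (u i)" for i
    unfolding u_def
    by (intro Bochner_Integration.integrable_sum integrable_mult_left integrable_std_gaussian_coordinate) auto
  obtain A where A: "A \<in> measurable_partitions d" and Amax: "\<And>i j x. x \<in> A i \<Longrightarrow> u j x \<le> u i x"
    using argmax_partition[of d "\<lambda>i l. v i \<bullet> m l"] unfolding u_def by blast
  have As: "A i \<in> sets (std_gaussian d)" for i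
    using A by (simp add: measurable_partitions_def)
  have max_eq: "(MAX i. u i x) = (\<Sum>i\<in>UNIV. indicator (A i) x * u i x)"
    if "x \<in> space (std_gaussian d)" for x
  proof -
    have "x \<in> (\<Union>i. A i)" using A that by (simp add: measurable_partitions_def)
    then obtain i where i: "x \<in> A i" by blast
    have "indicator (A j) x = (if j = i then 1 else 0 :: real)" for j
      using A i unfolding measurable_partitions_def disjoint_family_on_def by (auto split: split_indicator)
    then have "(\<Sum>i\<in>UNIV. indicator (A i) x * u i x) = u i x"
      by (simp add: mult_delta_left)
    moreover have "(MAX i. u i x) = u i x"
      using Amax[OF i] by (intro Max_eqI) auto
    ultimately show ?thesis by simp
  qed
  have int: "integrable (std_gaussian d) (\<lambda>x. indicator (A i) x * u i x)" for i
    using integrable_mult_indicator[OF As int_u] by simp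
  have int2: "integrable (std_gaussian d) (\<lambda>x. indicator (A i) x * x l)" if "l < d" for i l
    using integrable_mult_indicator[OF As integrable_std_gaussian_coordinate[OF that]] by simp
  have "integrable (std_gaussian d) (\<lambda>x. \<Sum>i\<in>UNIV. indicator (A i) x * u i x)"
    by (intro Bochner_Integration.integrable_sum int)
  then show "integrable (std_gaussian d) (\<lambda>x. MAX i. \<Sum>l<d. x l * (v i \<bullet> m l))"
    using max_eq unfolding u_def by (subst Bochner_Integration.integrable_cong) auto
  \<comment> \<open>The expected maximum will be the pairing of these vectors with \<open>m\<close>,
    and their squared norms add up to the value of the partition \<open>A\<close>.\<close>
  define g where "g l = (\<Sum>i\<in>UNIV. gaussian_moment d (A i) l *\<^sub>R v i)" for l
  have "(\<integral>x. (MAX i. u i x) \<partial>std_gaussian d) = (\<integral>x. (\<Sum>i\<in>UNIV. indicator (A i) x * u i x) \<partial>std_gaussian d)"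
    using max_eq by (intro Bochner_Integration.integral_cong) auto
  also have "\<dots> = (\<Sum>i\<in>UNIV. \<integral>x. indicator (A i) x * u i x \<partial>std_gaussian d)"
    by (intro Bochner_Integration.integral_sum int)
  also have "\<dots> = (\<Sum>i\<in>UNIV. \<integral>x. (\<Sum>l<d. (indicator (A i) x * x l) * (v i \<bullet> m l)) \<partial>std_gaussian d)"
    by (simp add: u_def sum_distrib_left mult_ac)
  also have "\<dots> = (\<Sum>i\<in>UNIV. \<Sum>l<d. \<integral>x. (indicator (A i) x * x l) * (v i \<bullet> m l) \<partial>std_gaussian d)"
    using int2 by (intro sum.cong refl Bochner_Integration.integral_sum integrable_mult_left) auto
  also have "\<dots> = (\<Sum>i\<in>UNIV. \<Sum>l<d. gaussian_moment d (A i) l * (v i \<bullet> m l))"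
    using int2 by (intro sum.cong refl) (simp add: gaussian_moment_def set_lebesgue_integral_def)
  also have "\<dots> = (\<Sum>l<d. g l \<bullet> m l)"
    unfolding g_def by (subst sum.swap) (simp add: inner_sum_left)
  also have "\<dots> \<le> (\<Sum>l<d. \<bar>norm (g l)\<bar> * \<bar>norm (m l)\<bar>)"
    by (intro sum_mono) (simp add: norm_cauchy_schwarz)
  also have "\<dots> \<le> L2_set (\<lambda>l. norm (g l)) {..<d} * L2_set (\<lambda>l. norm (m l)) {..<d}"
    by (rule L2_set_mult_ineq)
  also have "\<dots> \<le> L2_set (\<lambda>l. norm (g l)) {..<d} * 1"
    using m by (intro mult_left_mono) (auto simp: L2_set_def sum_nonneg)
  also have "\<dots> = sqrt (partition_value B d A)"
    by (simp add: partition_value_eq[OF B] L2_set_def g_def)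
  also have "\<dots> \<le> sqrt (C_max B)"
    unfolding C_max_def d_def[symmetric]
    by (intro real_sqrt_le_mono cSUP_upper A bdd_above_partition_value)
  finally show "(\<integral>x. (MAX i. \<Sum>l<d. x l * (v i \<bullet> m l)) \<partial>std_gaussian d) \<le> sqrt (C_max B)"
    unfolding u_def .
qed

lemma avg_gauss_softmax_le:
  fixes B :: "real^'k^'k" and v :: "'k::finite \<Rightarrow> real^'k" and m :: "nat \<Rightarrow> real^'k"
  defines "d \<equiv> CARD('k) - 1"
  assumes B: "\<And>i j. B $ i $ j = v i \<bullet> v j" and m: "(\<Sum>l<d. (norm (m l))\<^sup>2) \<le> 1" and \<theta>: "\<theta> > 0"
  shows "avg (gauss d (\<lambda>l. \<chi> i. v i \<bullet> m l)) (softmax \<theta>) 0 \<le> sqrt (C_max B) + ln CARD('k) / \<theta>"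
proof -
  interpret prob_space "std_gaussian d" by (rule prob_space_std_gaussian)
  note max = gaussian_max_le_C_max[where B = B and v = v and m = m, folded d_def, OF B m]
  have "avg (gauss d (\<lambda>l. \<chi> i. v i \<bullet> m l)) (softmax \<theta>) 0 =
      (\<integral>x. softmax \<theta> (0 + (\<Sum>l<d. x l *\<^sub>R (\<chi> i. v i \<bullet> m l))) \<partial>std_gaussian d)"
    by (rule avg_gauss[OF softmax_lipschitz[OF \<theta>]])
  also have "\<dots> \<le> (\<integral>x. (MAX i. \<Sum>l<d. x l * (v i \<bullet> m l)) + ln CARD('k) / \<theta> \<partial>std_gaussian d)"
  proof (rule integral_mono)
    show "integrable (std_gaussian d) (\<lambda>x. softmax \<theta> (0 + (\<Sum>l<d. x l *\<^sub>R (\<chi> i. v i \<bullet> m l))))"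
      by (rule integrable_gauss[OF softmax_lipschitz[OF \<theta>]])
    show "integrable (std_gaussian d) (\<lambda>x. (MAX i. \<Sum>l<d. x l * (v i \<bullet> m l)) + ln CARD('k) / \<theta>)"
      using max(1) by simp
    show "softmax \<theta> (0 + (\<Sum>l<d. x l *\<^sub>R (\<chi> i. v i \<bullet> m l)))
        \<le> (MAX i. \<Sum>l<d. x l * (v i \<bullet> m l)) + ln CARD('k) / \<theta>" for x
      by (rule softmax_le[OF \<theta>]) (auto simp: sum_component)
  qed
  also have "\<dots> \<le> sqrt (C_max B) + ln CARD('k) / \<theta>"
    using max by (simp add: prob_space)
  finally show ?thesis .
qed

section \<open>Level-one coefficients and the Lindeberg replacement\<close>

definition cube_mean :: "('k::finite \<Rightarrow> real) \<Rightarrow> nat \<Rightarrow> ((nat \<Rightarrow> 'k) \<Rightarrow> real) \<Rightarrow> real" where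
  "cube_mean \<mu> n g = (\<Sum>\<omega>\<in>cube n. (\<Prod>j<n. \<mu> (\<omega> j)) * g \<omega>)"

lemma finite_multi_indices: "finite (multi_indices k n)"
  by (auto simp: multi_indices_def intro!: finite_PiE)

lemma prod_basis_orthonormal:
  fixes X :: "nat \<Rightarrow> 'k::finite \<Rightarrow> real"
  assumes X: "orthonormal_basis_L2 \<mu> X"
    and "\<sigma> \<in> multi_indices CARD('k) n" "\<tau> \<in> multi_indices CARD('k) n"
  shows "cube_mean \<mu> n (\<lambda>\<omega>. prod_basis X n \<sigma> \<omega> * prod_basis X n \<tau> \<omega>) = (if \<sigma> = \<tau> then 1 else 0)"
proof -
  have "cube_mean \<mu> n (\<lambda>\<omega>. prod_basis X n \<sigma> \<omega> * prod_basis X n \<tau> \<omega>)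
      = (\<Sum>\<omega>\<in>cube n. \<Prod>j<n. \<mu> (\<omega> j) * (X (\<sigma> j) (\<omega> j) * X (\<tau> j) (\<omega> j)))"
    by (simp add: cube_mean_def prod_basis_def prod.distrib)
  also have "\<dots> = (\<Prod>j<n. inner_L2 \<mu> (X (\<sigma> j)) (X (\<tau> j)))"
    unfolding cube_def inner_L2_def by (subst prod_sum_PiE) auto
  also have "\<dots> = (\<Prod>j<n. if \<sigma> j = \<tau> j then 1 else 0)"
    using assms unfolding orthonormal_basis_L2_def multi_indices_def
    by (intro prod.cong refl) (auto simp: PiE_iff)
  also have "\<dots> = (if \<sigma> = \<tau> then 1 else 0)"
  proof (cases "\<forall>j<n. \<sigma> j = \<tau> j")
    case True
    then have "\<sigma> = \<tau>"
      using assms PiE_ext[of \<sigma> "{..<n}" "\<lambda>_. {..<CARD('k)}" \<tau>] unfolding multi_indices_def by blast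
    then show ?thesis by simp
  next
    case False
    then show ?thesis by (auto intro: prod_zero)
  qed
  finally show ?thesis .
qed

text \<open>Orthonormality turns the coefficient of the unique expansion into an inner product,
  which is explicit and linear in \<open>g\<close>.\<close>

lemma fourier_coeff_eq:
  fixes X :: "nat \<Rightarrow> 'k::finite \<Rightarrow> real"
  assumes X: "orthonormal_basis_L2 \<mu> X" and \<tau>: "\<tau> \<in> multi_indices CARD('k) n"
  shows "fourier_coeff X n g \<tau> = cube_mean \<mu> n (\<lambda>\<omega>. g \<omega> * prod_basis X n \<tau> \<omega>)"
proof -
  let ?M = "multi_indices CARD('k) n"
  define c where "c = fourier_coeff X n g"
  have "is_expansion X n g c"
    unfolding c_def fourier_coeff_def by (rule theI'[OF ex1_expansion[OF X]])
  then have g: "g \<omega> = (\<Sum>\<sigma>\<in>?M. c \<sigma> * prod_basis X n \<sigma> \<omega>)" if "\<omega> \<in> cube n" for \<omega>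
    using that by (auto simp: is_expansion_def)
  have "cube_mean \<mu> n (\<lambda>\<omega>. g \<omega> * prod_basis X n \<tau> \<omega>) =
      (\<Sum>\<omega>\<in>cube n. \<Sum>\<sigma>\<in>?M. c \<sigma> * ((\<Prod>j<n. \<mu> (\<omega> j)) * (prod_basis X n \<sigma> \<omega> * prod_basis X n \<tau> \<omega>)))"
    unfolding cube_mean_def by (intro sum.cong refl) (simp add: g sum_distrib_left sum_distrib_right mult_ac)
  also have "\<dots> = (\<Sum>\<sigma>\<in>?M. c \<sigma> * cube_mean \<mu> n (\<lambda>\<omega>. prod_basis X n \<sigma> \<omega> * prod_basis X n \<tau> \<omega>))"
    by (subst sum.swap) (simp add: sum_distrib_left cube_mean_def)
  also have "\<dots> = (\<Sum>\<sigma>\<in>?M. if \<sigma> = \<tau> then c \<sigma> else 0)"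
    using \<tau> by (intro sum.cong refl) (simp add: prod_basis_orthonormal[OF X])
  finally show ?thesis
    using \<tau> by (simp add: finite_multi_indices c_def)
qed

text \<open>Level-one multi-indices are encoded by pairs \<open>(j, l)\<close> with \<open>l < k - 1\<close>, standing for \<open>X (Suc l)\<close> at
  coordinate \<open>j\<close>.\<close>

definition unit_index :: "nat \<Rightarrow> nat \<times> nat \<Rightarrow> nat \<Rightarrow> nat" where
  "unit_index n s = (\<lambda>i\<in>{..<n}. if i = fst s then Suc (snd s) else 0)"

lemma unit_index_bij:
  "bij_betw (unit_index n) ({..<n} \<times> {..<k - 1}) {\<sigma>. \<sigma> \<in> multi_indices k n \<and> weight n \<sigma> = 1}"
  unfolding bij_betw_def
proof (intro conjI equalityI subsetI)
  show "inj_on (unit_index n) ({..<n} \<times> {..<k - 1})"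
  proof (rule inj_onI)
    fix s t assume *: "unit_index n s = unit_index n t" "s \<in> {..<n} \<times> {..<k - 1}" "t \<in> {..<n} \<times> {..<k - 1}"
    from fun_cong[OF *(1), of "fst s"] *(2,3) show "s = t"
      by (auto simp: unit_index_def prod_eq_iff split: if_splits)
  qed
next
  fix \<sigma> assume "\<sigma> \<in> unit_index n ` ({..<n} \<times> {..<k - 1})"
  then obtain j l where s: "\<sigma> = unit_index n (j, l)" "j < n" "l < k - 1" by auto
  have "{i. i < n \<and> \<sigma> i \<noteq> 0} = {j}" using s by (auto simp: unit_index_def split: if_splits)
  then have "weight n \<sigma> = 1" by (simp only: weight_def) simp
  moreover have "\<sigma> \<in> multi_indices k n"
    using s by (auto simp: multi_indices_def unit_index_def)
  ultimately show "\<sigma> \<in> {\<sigma>. \<sigma> \<in> multi_indices k n \<and> weight n \<sigma> = 1}" by simp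
next
  fix \<sigma> assume "\<sigma> \<in> {\<sigma>. \<sigma> \<in> multi_indices k n \<and> weight n \<sigma> = 1}"
  then have \<sigma>: "\<sigma> \<in> multi_indices k n" and "weight n \<sigma> = 1" by blast+
  from this(2) have "card {j. j < n \<and> \<sigma> j \<noteq> 0} = 1" unfolding weight_def .
  then obtain j where "{j. j < n \<and> \<sigma> j \<noteq> 0} = {j}" by (rule card_1_singletonE)
  then have j: "i < n \<and> \<sigma> i \<noteq> 0 \<longleftrightarrow> i = j" for i by blast
  from j[of j] have jn: "j < n" "\<sigma> j \<noteq> 0" by simp_all
  have k: "\<sigma> i < k" if "i < n" for i using \<sigma> that by (auto simp: multi_indices_def PiE_iff)
  \<comment> \<open>Index 0 stands for the constant function, so the encoding shifts the nonzero
    entry down by one.\<close>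
  have "unit_index n (j, \<sigma> j - 1) = \<sigma>"
  proof
    fix i
    consider "i = j" | "i \<noteq> j" "i < n" | "\<not> i < n" by blast
    then show "unit_index n (j, \<sigma> j - 1) i = \<sigma> i"
    proof cases
      case 2
      then have "\<sigma> i = 0" using j[of i] by simp
      with 2 show ?thesis by (simp add: unit_index_def)
    next
      case 3
      then have "\<sigma> i = undefined"
        using PiE_arb[OF \<sigma>[unfolded multi_indices_def], of i] by simp
      with 3 show ?thesis by (simp add: unit_index_def)
    qed (use jn in \<open>simp add: unit_index_def\<close>)
  qed
  moreover have "(j, \<sigma> j - 1) \<in> {..<n} \<times> {..<k - 1}"
    using jn k[OF jn(1)] by auto
  ultimately show "\<sigma> \<in> unit_index n ` ({..<n} \<times> {..<k - 1})"
    by (metis image_eqI)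
qed

lemma prod_basis_unit_index:
  assumes "X 0 = (\<lambda>_. 1)" "j < n"
  shows "prod_basis X n (unit_index n (j, l)) \<omega> = X (Suc l) (\<omega> j)"
proof -
  have "prod_basis X n (unit_index n (j, l)) \<omega> = (\<Prod>i<n. if i = j then X (Suc l) (\<omega> j) else 1)"
    unfolding prod_basis_def using assms by (intro prod.cong refl) (auto simp: unit_index_def)
  then show ?thesis using assms by simp
qed

definition level_one ::
    "('k::finite \<Rightarrow> real) \<Rightarrow> (nat \<Rightarrow> 'k \<Rightarrow> real) \<Rightarrow> nat \<Rightarrow> ((nat \<Rightarrow> 'k) \<Rightarrow> real) \<Rightarrow> nat \<times> nat \<Rightarrow> real" where
  "level_one \<mu> X n g s = cube_mean \<mu> n (\<lambda>\<omega>. g \<omega> * X (Suc (snd s)) (\<omega> (fst s)))"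

lemma fourier_coeff_unit_index:
  fixes X :: "nat \<Rightarrow> 'k::finite \<Rightarrow> real"
  assumes X: "orthonormal_basis_L2 \<mu> X" "X 0 = (\<lambda>_. 1)" and s: "s \<in> {..<n} \<times> {..<CARD('k) - 1}"
  shows "fourier_coeff X n g (unit_index n s) = level_one \<mu> X n g s"
proof -
  have "unit_index n s \<in> multi_indices CARD('k) n"
    using bij_betw_apply[OF unit_index_bij s] by simp
  then show ?thesis
    using s by (cases s) (simp add: fourier_coeff_eq[OF X(1)] level_one_def prod_basis_unit_index X(2))
qed

lemma OBJ_eq_level_one:
  fixes X :: "nat \<Rightarrow> 'k::finite \<Rightarrow> real"
  assumes X: "orthonormal_basis_L2 \<mu> X" "X 0 = (\<lambda>_. 1)"
  shows "OBJ B X n f = (\<Sum>i\<in>UNIV. \<Sum>j\<in>UNIV. B $ i $ j * (\<Sum>s\<in>{..<n} \<times> {..<CARD('k) - 1}.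
    level_one \<mu> X n (\<lambda>\<omega>. f \<omega> $ i) s * level_one \<mu> X n (\<lambda>\<omega>. f \<omega> $ j) s))"
  unfolding OBJ_def
  by (intro sum.cong refl arg_cong2[of _ _ _ _ "(*)"], subst sum.reindex_bij_betw[OF unit_index_bij, symmetric])
    (simp add: fourier_coeff_unit_index[OF X])

text \<open>A degree bound of at least 1 admits the level-one multi-indices, so this square is one
  of the nonnegative summands of the influence of \<open>j\<close>.\<close>

lemma level_one_le_influence:
  fixes X :: "nat \<Rightarrow> 'k::finite \<Rightarrow> real"
  assumes X: "orthonormal_basis_L2 \<mu> X" "X 0 = (\<lambda>_. 1)" and j: "j < n" and l: "l < CARD('k) - 1" and m: "1 \<le> m"
  shows "(level_one \<mu> X n g (j, l))\<^sup>2 \<le> low_degree_influence X n m j g"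
proof -
  let ?\<sigma> = "unit_index n (j, l)"
  have "?\<sigma> \<in> {\<sigma>. \<sigma> \<in> multi_indices CARD('k) n \<and> weight n \<sigma> = 1}"
    by (rule bij_betw_apply[OF unit_index_bij]) (use j l in simp)
  then have \<sigma>: "?\<sigma> \<in> multi_indices CARD('k) n" "weight n ?\<sigma> = 1" by blast+
  have "?\<sigma> j \<noteq> 0" using j by (simp add: unit_index_def)
  then have "(fourier_coeff X n g ?\<sigma>)\<^sup>2 \<le> low_degree_influence X n m j g"
    unfolding low_degree_influence_def
    using \<sigma> m finite_multi_indices by (intro member_le_sum) auto
  then show ?thesis
    using j l by (simp add: fourier_coeff_unit_index[OF X])
qed

section \<open>Means over the cube as composed averages, and the Lindeberg replacement\<close>

lemma sum_cube_Suc: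
  fixes G :: "(nat \<Rightarrow> 'k::finite) \<Rightarrow> real"
  shows "(\<Sum>\<omega>\<in>cube (Suc n). G \<omega>) = (\<Sum>\<omega>\<in>cube n. \<Sum>i\<in>UNIV. G (fun_upd \<omega> n i))"
proof -
  have "cube (Suc n) = (\<lambda>(i, \<omega>). fun_upd \<omega> n i) ` (UNIV \<times> (cube n :: (nat \<Rightarrow> 'k) set))"
    unfolding cube_def lessThan_Suc by (subst PiE_insert_eq) simp
  moreover have "inj_on (\<lambda>(i, \<omega>). fun_upd \<omega> n i) (UNIV \<times> (cube n :: (nat \<Rightarrow> 'k) set))"
    unfolding cube_def using inj_combinator[of n "{..<n}" "\<lambda>_. UNIV :: 'k set"] by simp
  ultimately have "(\<Sum>\<omega>\<in>cube (Suc n). G \<omega>) = (\<Sum>(i, \<omega>)\<in>UNIV \<times> (cube n :: (nat \<Rightarrow> 'k) set). G (fun_upd \<omega> n i))"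
    by (simp add: sum.reindex case_prod_beta')
  then show ?thesis
    by (simp add: sum.cartesian_product[symmetric] sum.swap[of _ "cube n"])
qed

lemma integral_finite_distr:
  fixes \<xi> :: "'k::finite \<Rightarrow> 'a::euclidean_space" and F :: "'a \<Rightarrow> real"
  assumes "F \<in> borel_measurable borel"
  shows "(\<integral>h. F h \<partial>distr (measure_pmf P) borel \<xi>) = (\<Sum>i\<in>UNIV. pmf P i * F (\<xi> i))"
  using assms by (subst integral_distr) (simp_all add: integral_measure_pmf[of UNIV])

lemma integrable_finite_distr:
  fixes \<xi> :: "'k::finite \<Rightarrow> 'a::euclidean_space" and F :: "'a \<Rightarrow> real"
  assumes "F \<in> borel_measurable borel"
  shows "integrable (distr (measure_pmf P) borel \<xi>) F"
  using assms by (subst integrable_distr_eq) (simp_all add: integrable_measure_pmf_finite)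

lemma integrable_law_finite_distr:
  "integrable_law (distr (measure_pmf P) borel \<xi>)" for \<xi> :: "'k::finite \<Rightarrow> 'a::euclidean_space"
  unfolding integrable_law_def
  by (simp add: integrable_finite_distr measure_pmf.prob_space_distr)

text \<open>The bridge from the product space to averaging operators: the coordinates are
  independent, and the last one is integrated out in each induction step.\<close>

lemma cube_mean_sum:
  fixes \<xi> :: "nat \<Rightarrow> 'k::finite \<Rightarrow> 'a::euclidean_space"
  assumes F: "1-lipschitz_on UNIV F"
  shows "cube_mean (pmf P) n (\<lambda>\<omega>. F (x + (\<Sum>j<n. \<xi> j (\<omega> j)))) =
    avgs (\<lambda>j. distr (measure_pmf P) borel (\<xi> j)) [0..<n] F x"
  using F
proof (induction n arbitrary: F)
  case 0
  then show ?case by (simp add: cube_mean_def cube_def)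
next
  case (Suc n)
  let ?U = "\<lambda>j. distr (measure_pmf P) borel (\<xi> j)"
  have [measurable]: "F \<in> borel_measurable borel" by (rule lipschitz_borel[OF Suc.prems])
  have avg: "avg (?U n) F y = (\<Sum>i\<in>UNIV. pmf P i * F (y + \<xi> n i))" for y
    unfolding avg_def by (rule integral_finite_distr) measurable
  have "cube_mean (pmf P) (Suc n) (\<lambda>\<omega>. F (x + (\<Sum>j<Suc n. \<xi> j (\<omega> j)))) =
      cube_mean (pmf P) n (\<lambda>\<omega>. avg (?U n) F (x + (\<Sum>j<n. \<xi> j (\<omega> j))))"
    unfolding cube_mean_def sum_cube_Suc
    by (intro sum.cong refl) (simp add: avg sum_distrib_left mult_ac add_ac)
  also have "\<dots> = avgs ?U [0..<n] (avg (?U n) F) x"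
    by (rule Suc.IH) (intro avg_lipschitz integrable_law_finite_distr Suc.prems)
  finally show ?case by simp
qed

text \<open>Orthogonality to \<open>X 0\<close>, the constant 1, makes the block centered, and
  orthonormality of the other basis functions gives it the covariance of \<open>gauss d a\<close>.
  The moment comparison then leaves only third moments.\<close>

lemma lindeberg_block:
  fixes X :: "nat \<Rightarrow> 'k::finite \<Rightarrow> real" and a :: "nat \<Rightarrow> real^'k"
  defines "d \<equiv> CARD('k) - 1"
  assumes X: "orthonormal_basis_L2 (pmf P) X" "X 0 = (\<lambda>_. 1)"
    and H: "\<And>l i. l < d \<Longrightarrow> \<bar>X (Suc l) i\<bar> \<le> H" "H \<ge> 0" and \<theta>: "\<theta> > 0"
  shows "\<bar>avg (distr (measure_pmf P) borel (\<lambda>i. \<Sum>l<d. X (Suc l) i *\<^sub>R a l)) (softmax \<theta>) x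
      - avg (gauss d a) (softmax \<theta>) x\<bar> \<le> \<theta>\<^sup>2 * (H ^ 3 + gauss_third d) * (\<Sum>l<d. norm (a l)) ^ 3"
proof -
  let ?\<xi> = "\<lambda>i. \<Sum>l<d. X (Suc l) i *\<^sub>R a l"
  let ?U = "distr (measure_pmf P) borel ?\<xi>"
  \<comment> \<open>The bound by \<open>d\<close> is inclusive: \<open>d\<close> is one less than
    the size of the alphabet, so these are exactly the basis indices, with 0 among them.\<close>
  have orth: "(\<Sum>p\<in>UNIV. pmf P p * (X b p * X c p)) = (if b = c then 1 else 0)" if "b \<le> d" "c \<le> d" for b c
    using X(1) that unfolding orthonormal_basis_L2_def inner_L2_def d_def
    by (metis Suc_pred' le_imp_less_Suc zero_less_card_finite)
  have mean: "(\<integral>h. h $ i \<partial>?U) = 0" for i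
  proof -
    have "(\<integral>h. h $ i \<partial>?U) = (\<Sum>p\<in>UNIV. \<Sum>l<d. a l $ i * (pmf P p * (X (Suc l) p * X 0 p)))"
      by (subst integral_finite_distr[OF borel_measurable_vec_nth])
        (simp add: sum_distrib_left X(2) mult_ac)
    also have "\<dots> = (\<Sum>l<d. a l $ i * (\<Sum>p\<in>UNIV. pmf P p * (X (Suc l) p * X 0 p)))"
      by (subst sum.swap) (simp add: sum_distrib_left)
    finally show ?thesis by (simp add: orth)
  qed
  have second: "(\<integral>h. h $ i * h $ j \<partial>?U) = (\<Sum>l<d. a l $ i * a l $ j)" for i j
  proof -
    have "(\<integral>h. h $ i * h $ j \<partial>?U) = (\<Sum>p\<in>UNIV. \<Sum>l<d. \<Sum>m<d.
        a l $ i * (a m $ j * (pmf P p * (X (Suc l) p * X (Suc m) p))))"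
    proof (subst integral_finite_distr[OF borel_measurable_times[OF borel_measurable_vec_nth borel_measurable_vec_nth]],
        intro sum.cong refl)
      fix p
      have c: "?\<xi> p $ i = (\<Sum>l<d. X (Suc l) p * a l $ i)" for i by (simp add: sum_component)
      show "pmf P p * (?\<xi> p $ i * ?\<xi> p $ j) =
          (\<Sum>l<d. \<Sum>m<d. a l $ i * (a m $ j * (pmf P p * (X (Suc l) p * X (Suc m) p))))"
        unfolding c sum_product unfolding sum_distrib_left by (intro sum.cong refl) (simp add: mult_ac)
    qed
    also have "\<dots> = (\<Sum>l<d. \<Sum>p\<in>UNIV. \<Sum>m<d. a l $ i * (a m $ j * (pmf P p * (X (Suc l) p * X (Suc m) p))))"
      by (rule sum.swap)
    also have "\<dots> = (\<Sum>l<d. \<Sum>m<d. \<Sum>p\<in>UNIV. a l $ i * (a m $ j * (pmf P p * (X (Suc l) p * X (Suc m) p))))"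
      by (intro sum.cong refl sum.swap)
    also have "\<dots> = (\<Sum>l<d. \<Sum>m<d. a l $ i * (a m $ j * (if l = m then 1 else 0)))"
      by (intro sum.cong refl) (simp add: sum_distrib_left[symmetric] orth)
    finally show ?thesis by (simp add: mult_delta_right)
  qed
  have third: "(\<integral>h. norm h ^ 3 \<partial>?U) \<le> H ^ 3 * (\<Sum>l<d. norm (a l)) ^ 3"
  proof -
    have "norm (?\<xi> p) ^ 3 \<le> H ^ 3 * (\<Sum>l<d. norm (a l)) ^ 3" for p
    proof -
      have "norm (?\<xi> p) \<le> (\<Sum>l<d. H * norm (a l))"
        by (intro sum_norm_le) (auto intro: mult_right_mono H)
      then have "norm (?\<xi> p) ^ 3 \<le> (\<Sum>l<d. H * norm (a l)) ^ 3"
        by (rule power_mono) simp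
      then show ?thesis by (simp add: sum_distrib_left[symmetric] power_mult_distrib)
    qed
    then have "(\<Sum>p\<in>UNIV. pmf P p * norm (?\<xi> p) ^ 3) \<le> (\<Sum>p\<in>UNIV. pmf P p * (H ^ 3 * (\<Sum>l<d. norm (a l)) ^ 3))"
      by (intro sum_mono mult_left_mono) auto
    also have "\<dots> = H ^ 3 * (\<Sum>l<d. norm (a l)) ^ 3"
      unfolding sum_distrib_right[symmetric] by (simp add: sum_pmf_eq_1)
    finally show ?thesis
      by (subst integral_finite_distr) auto
  qed
  have "\<bar>avg ?U (softmax \<theta>) x - avg (gauss d a) (softmax \<theta>) x\<bar>
      \<le> \<theta>\<^sup>2 * ((\<integral>h. norm h ^ 3 \<partial>?U) + (\<integral>h. norm h ^ 3 \<partial>gauss d a))"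
    by (intro avg_softmax_diff_le integrable_law_finite_distr integrable_law_gauss integrable_finite_distr
        gauss_third_moment \<theta>) (simp_all add: mean second gauss_mean gauss_second_moment)
  also have "\<dots> \<le> \<theta>\<^sup>2 * (H ^ 3 * (\<Sum>l<d. norm (a l)) ^ 3 + gauss_third d * (\<Sum>l<d. norm (a l)) ^ 3)"
    by (intro mult_left_mono add_mono third gauss_third_moment) auto
  finally show ?thesis by (simp add: algebra_simps)
qed

text \<open>Writes \<open>n\<close> independent Gaussian blocks as a single \<open>gauss\<close>,
  the shape in which \<open>avg_gauss_softmax_eq\<close> compares covariances.\<close>

lemma avgs_gauss_merge:
  fixes a :: "nat \<Rightarrow> nat \<Rightarrow> real^'k::finite"
  obtains e c where "\<And>F. 1-lipschitz_on UNIV F \<Longrightarrow> avgs (\<lambda>j. gauss d (a j)) [0..<n] F = avg (gauss e c) F"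
    and "\<And>i i'. (\<Sum>l<e. c l $ i * c l $ i') = (\<Sum>j<n. \<Sum>l<d. a j l $ i * a j l $ i')"
proof -
  have "\<exists>e c. (\<forall>F. 1-lipschitz_on UNIV F \<longrightarrow> avgs (\<lambda>j. gauss d (a j)) [0..<n] F = avg (gauss e c) F)
    \<and> (\<forall>i i'. (\<Sum>l<e. c l $ i * c l $ i') = (\<Sum>j<n. \<Sum>l<d. a j l $ i * a j l $ i'))"
  proof (induction n)
    case 0
    show ?case by (intro exI[of _ 0] exI[of _ "\<lambda>_. 0"]) (simp add: avg_gauss_0)
  next
    case (Suc n)
    then obtain e c where IH:
      "\<And>F. 1-lipschitz_on UNIV F \<Longrightarrow> avgs (\<lambda>j. gauss d (a j)) [0..<n] F = avg (gauss e c) F"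
      "\<And>i i'. (\<Sum>l<e. c l $ i * c l $ i') = (\<Sum>j<n. \<Sum>l<d. a j l $ i * a j l $ i')"
      by blast
    define c' where "c' l = (if l < e then c l else a n (l - e))" for l
    have "avgs (\<lambda>j. gauss d (a j)) [0..<Suc n] F = avg (gauss (e + d) c') F" if "1-lipschitz_on UNIV F" for F
      using that by (simp add: IH(1) avg_lipschitz integrable_law_gauss avg_gauss_add c'_def[abs_def])
    moreover have "(\<Sum>l<e + d. c' l $ i * c' l $ i') = (\<Sum>j<Suc n. \<Sum>l<d. a j l $ i * a j l $ i')" for i i'
    proof -
      have "(\<Sum>l<e + m. c' l $ i * c' l $ i') = (\<Sum>l<e. c l $ i * c l $ i') + (\<Sum>l<m. a n l $ i * a n l $ i')" for m
        by (induction m) (auto simp: c'_def)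
      then show ?thesis by (simp add: IH(2))
    qed
    ultimately show ?case by blast
  qed
  then show ?thesis using that by blast
qed

text \<open>The summands at one coordinate \<open>j\<close> are functions of the same
  \<open>\<omega> j\<close>, uncorrelated but in general dependent, so they are replaced together as
  a block. The Gaussian blocks are then merged and exchanged for \<open>gauss e c\<close>, which has
  the same covariance.\<close>

lemma lindeberg:
  fixes X :: "nat \<Rightarrow> 'k::finite \<Rightarrow> real" and a :: "nat \<Rightarrow> nat \<Rightarrow> real^'k" and c :: "nat \<Rightarrow> real^'k"
  defines "d \<equiv> CARD('k) - 1"
  assumes X: "orthonormal_basis_L2 (pmf P) X" "X 0 = (\<lambda>_. 1)"
    and H: "\<And>l i. l < d \<Longrightarrow> \<bar>X (Suc l) i\<bar> \<le> H" "H \<ge> 0" and \<theta>: "\<theta> > 0"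
    and cov: "\<And>i i'. (\<Sum>j<n. \<Sum>l<d. a j l $ i * a j l $ i') = (\<Sum>l<e. c l $ i * c l $ i')"
  shows "\<bar>cube_mean (pmf P) n (\<lambda>\<omega>. softmax \<theta> (\<Sum>j<n. \<Sum>l<d. X (Suc l) (\<omega> j) *\<^sub>R a j l))
      - avg (gauss e c) (softmax \<theta>) 0\<bar>
    \<le> \<theta>\<^sup>2 * (H ^ 3 + gauss_third d) * (\<Sum>j<n. (\<Sum>l<d. norm (a j l)) ^ 3)"
proof -
  let ?K = "\<theta>\<^sup>2 * (H ^ 3 + gauss_third d)"
  note F = softmax_lipschitz[OF \<theta>]
  define U where "U j = distr (measure_pmf P) borel (\<lambda>i. \<Sum>l<d. X (Suc l) i *\<^sub>R a j l)" for j
  have "cube_mean (pmf P) n (\<lambda>\<omega>. softmax \<theta> (\<Sum>j<n. \<Sum>l<d. X (Suc l) (\<omega> j) *\<^sub>R a j l)) =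
      avgs U [0..<n] (softmax \<theta>) 0"
    using cube_mean_sum[OF F, where x = 0] by (simp add: U_def)
  moreover have "avgs (\<lambda>j. gauss d (a j)) [0..<n] (softmax \<theta>) 0 = avg (gauss e c) (softmax \<theta>) 0"
  proof -
    obtain e' c' where *:
      "\<And>F. 1-lipschitz_on UNIV F \<Longrightarrow> avgs (\<lambda>j. gauss d (a j)) [0..<n] F = avg (gauss e' c') F"
      "\<And>i i'. (\<Sum>l<e'. c' l $ i * c' l $ i') = (\<Sum>j<n. \<Sum>l<d. a j l $ i * a j l $ i')"
      by (rule avgs_gauss_merge[of d a n]) blast
    show ?thesis
      unfolding *(1)[OF F] by (rule avg_gauss_softmax_eq[OF \<theta>]) (simp add: *(2) cov)
  qed
  moreover have "\<bar>avgs U [0..<n] (softmax \<theta>) 0 - avgs (\<lambda>j. gauss d (a j)) [0..<n] (softmax \<theta>) 0\<bar>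
      \<le> (\<Sum>j\<leftarrow>[0..<n]. ?K * (\<Sum>l<d. norm (a j l)) ^ 3)"
    unfolding U_def
    by (intro avgs_replace integrable_law_finite_distr integrable_law_gauss F
        lindeberg_block[where P = P and X = X, folded d_def] X H \<theta>)
  ultimately show ?thesis
    by (simp add: interv_sum_list_conv_sum_set_nat atLeast0LessThan sum_distrib_left)
qed

section \<open>Duality bound for the square root of the objective\<close>

lemma cube_mean_sum_distrib:
  "cube_mean \<mu> n (\<lambda>\<omega>. \<Sum>i\<in>I. g i \<omega>) = (\<Sum>i\<in>I. cube_mean \<mu> n (g i))"
  unfolding cube_mean_def sum_distrib_left by (rule sum.swap)

lemma cube_mean_mult_right:
  "cube_mean \<mu> n (\<lambda>\<omega>. g \<omega> * a) = cube_mean \<mu> n g * a"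
  by (simp add: cube_mean_def sum_distrib_right mult.assoc)

lemma cube_mean_mono:
  assumes "\<And>\<omega>. \<omega> \<in> cube n \<Longrightarrow> g \<omega> \<le> h \<omega>"
  shows "cube_mean (pmf P) n g \<le> cube_mean (pmf P) n h"
  unfolding cube_mean_def using assms by (intro sum_mono mult_left_mono prod_nonneg) auto

text \<open>The components of \<open>f\<close> add up to the constant 1, and every level-one basis
  function is orthogonal to constants. This is the relation that \<open>gram_realization\<close>
  uses to save one dimension.\<close>

lemma sum_level_one_eq_0:
  fixes X :: "nat \<Rightarrow> 'k::finite \<Rightarrow> real"
  assumes X: "orthonormal_basis_L2 \<mu> X" "X 0 = (\<lambda>_. 1)" and s: "s \<in> {..<n} \<times> {..<CARD('k) - 1}"
    and f: "\<And>\<omega>. \<omega> \<in> cube n \<Longrightarrow> f \<omega> \<in> prob_simplex"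
  shows "(\<Sum>i\<in>UNIV. level_one \<mu> X n (\<lambda>\<omega>. f \<omega> $ i) s) = 0"
proof -
  define \<sigma> where "\<sigma> = (\<lambda>i\<in>{..<n}. 0 :: nat)"
  have \<sigma>: "\<sigma> \<in> multi_indices CARD('k) n" by (auto simp: \<sigma>_def multi_indices_def)
  have s': "unit_index n s \<in> multi_indices CARD('k) n"
    using bij_betw_apply[OF unit_index_bij s] by blast
  have "unit_index n s (fst s) \<noteq> \<sigma> (fst s)"
    using s by (auto simp: unit_index_def \<sigma>_def)
  then have ne: "unit_index n s \<noteq> \<sigma>" by auto
  have "(\<Sum>i\<in>UNIV. level_one \<mu> X n (\<lambda>\<omega>. f \<omega> $ i) s) =
      cube_mean \<mu> n (\<lambda>\<omega>. (\<Sum>i\<in>UNIV. f \<omega> $ i) * X (Suc (snd s)) (\<omega> (fst s)))"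
    unfolding level_one_def cube_mean_sum_distrib[symmetric] sum_distrib_right ..
  also have "\<dots> = cube_mean \<mu> n (\<lambda>\<omega>. prod_basis X n (unit_index n s) \<omega> * prod_basis X n \<sigma> \<omega>)"
    unfolding cube_mean_def
  proof (intro sum.cong refl)
    fix \<omega> :: "nat \<Rightarrow> 'k" assume "\<omega> \<in> cube n"
    then have "(\<Sum>i\<in>UNIV. f \<omega> $ i) = 1" using f by (simp add: prob_simplex_def)
    moreover have "prod_basis X n \<sigma> \<omega> = 1" by (simp add: prod_basis_def \<sigma>_def X(2))
    moreover have "prod_basis X n (unit_index n s) \<omega> = X (Suc (snd s)) (\<omega> (fst s))"
      using prod_basis_unit_index[of X "fst s" n "snd s" \<omega>] X(2) s by auto
    ultimately show "(\<Prod>j<n. \<mu> (\<omega> j)) * ((\<Sum>i\<in>UNIV. f \<omega> $ i) * X (Suc (snd s)) (\<omega> (fst s))) =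
        (\<Prod>j<n. \<mu> (\<omega> j)) * (prod_basis X n (unit_index n s) \<omega> * prod_basis X n \<sigma> \<omega>)" by simp
  qed
  also have "\<dots> = 0"
    using prod_basis_orthonormal[OF X(1) s' \<sigma>] ne by simp
  finally show ?thesis .
qed

text \<open>The quantitative core: a smoothing error of order 1/\<theta> and a replacement error
  linear in the coefficient bound \<open>t\<close>. On the right, \<open>n\<close> and
  \<open>f\<close> enter only through \<open>t\<close> and \<open>r\<close>.\<close>

lemma sqrt_OBJ_le:
  fixes B :: "real^'k^'k" and v :: "'k::finite \<Rightarrow> real^'k" and X :: "nat \<Rightarrow> 'k \<Rightarrow> real" and n :: nat and f :: "(nat \<Rightarrow> 'k) \<Rightarrow> real^'k"
  defines "d \<equiv> CARD('k) - 1" and "V \<equiv> (\<Sum>i\<in>UNIV. norm (v i))" and "r \<equiv> sqrt (OBJ B X n f)"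
  assumes B: "\<And>i j. B $ i $ j = v i \<bullet> v j"
    and X: "orthonormal_basis_L2 (pmf P) X" "X 0 = (\<lambda>_. 1)"
    and H: "\<And>l i. l < d \<Longrightarrow> \<bar>X (Suc l) i\<bar> \<le> H" "H \<ge> 0" and \<theta>: "\<theta> > 0"
    and f: "\<And>\<omega>. \<omega> \<in> cube n \<Longrightarrow> f \<omega> \<in> prob_simplex"
    and t: "\<And>i s. s \<in> {..<n} \<times> {..<d} \<Longrightarrow> \<bar>level_one (pmf P) X n (\<lambda>\<omega>. f \<omega> $ i) s\<bar> \<le> t"
    and r: "r > 0"
  shows "r \<le> sqrt (C_max B) + ln CARD('k) / \<theta> + \<theta>\<^sup>2 * (H ^ 3 + gauss_third d) * (real d ^ 2 * V ^ 4 * t / r)"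
proof -
  define S where "S = {..<n} \<times> {..<d}"
  define z where "z i s = level_one (pmf P) X n (\<lambda>\<omega>. f \<omega> $ i) s" for i s
  define m where "m s = (\<Sum>i\<in>UNIV. z i s *\<^sub>R v i)" for s
  have r2: "r\<^sup>2 = OBJ B X n f" using r by (simp add: r_def)
  have r2m: "r\<^sup>2 = (\<Sum>s\<in>S. (norm (m s))\<^sup>2)"
    unfolding r2 OBJ_eq_level_one[OF X] B m_def S_def d_def[symmetric] z_def[symmetric] by (rule sum_gram_norm)
  \<comment> \<open>Division by \<open>r\<close> gives the family \<open>m\<close> total squared
    norm one; coordinate \<open>i\<close> then pairs it with \<open>v i\<close>.\<close>
  define a where "a j l = (\<chi> i. v i \<bullet> ((1 / r) *\<^sub>R m (j, l)))" for j l

  obtain \<zeta> where \<zeta>: "(\<Sum>l<d. \<zeta> i l * \<zeta> j l) = (\<Sum>s\<in>S. z i s * z j s)" for i j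
    unfolding d_def
  proof (rule gram_realization[of S z])
    fix s assume "s \<in> S"
    then show "(\<Sum>i\<in>UNIV. z i s) = 0"
      unfolding z_def S_def d_def by (intro sum_level_one_eq_0[OF X _ f])
  qed (auto simp: S_def)
  \<comment> \<open>The same combination formed from \<zeta>, with \<open>d\<close> columns in place
    of the index set \<open>S\<close>. Equal Gram matrices preserve both the covariance and the
    total norm.\<close>
  define m' where "m' l = (1 / r) *\<^sub>R (\<Sum>i\<in>UNIV. \<zeta> i l *\<^sub>R v i)" for l
  define c where "c l = (\<chi> i. v i \<bullet> m' l)" for l
  have "(\<Sum>l<d. (norm (\<Sum>i\<in>UNIV. \<zeta> i l *\<^sub>R v i))\<^sup>2) = r\<^sup>2"
    unfolding sum_gram_norm[symmetric] \<zeta> unfolding r2m m_def by (rule sum_gram_norm)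
  then have m'1: "(\<Sum>l<d. (norm (m' l))\<^sup>2) \<le> 1"
    using r by (simp add: m'_def power_mult_distrib power_divide sum_divide_distrib[symmetric])
  have cov: "(\<Sum>j<n. \<Sum>l<d. a j l $ i * a j l $ i') = (\<Sum>l<d. c l $ i * c l $ i')" for i i'
  proof -
    let ?\<alpha> = "\<lambda>i p. (v i \<bullet> v p) / r"
    have "(\<Sum>j<n. \<Sum>l<d. a j l $ i * a j l $ i') = (\<Sum>s\<in>S. (\<Sum>p\<in>UNIV. ?\<alpha> i p * z p s) * (\<Sum>q\<in>UNIV. ?\<alpha> i' q * z q s))"
      unfolding S_def sum.cartesian_product
      by (intro sum.cong refl) (auto simp: a_def m_def inner_sum_right sum_divide_distrib mult_ac)
    also have "\<dots> = (\<Sum>l<d. (\<Sum>p\<in>UNIV. ?\<alpha> i p * \<zeta> p l) * (\<Sum>q\<in>UNIV. ?\<alpha> i' q * \<zeta> q l))"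
      unfolding sum_bilinear \<zeta> ..
    also have "\<dots> = (\<Sum>l<d. c l $ i * c l $ i')"
      by (intro sum.cong refl) (auto simp: c_def m'_def inner_sum_right sum_divide_distrib mult_ac)
    finally show ?thesis .
  qed

  define Y where "Y \<omega> = (\<Sum>j<n. \<Sum>l<d. X (Suc l) (\<omega> j) *\<^sub>R a j l)" for \<omega>
  have Yi: "Y \<omega> $ i = (\<Sum>s\<in>S. X (Suc (snd s)) (\<omega> (fst s)) * ((v i \<bullet> m s) / r))" for \<omega> i
    unfolding Y_def S_def sum.cartesian_product
    by (simp add: sum_component a_def case_prod_beta' sum.cartesian_product)
  \<comment> \<open>Duality: pairing the normalised \<open>m / r\<close> with \<open>m\<close>
    recovers \<open>r\<close>. Expanding one copy of \<open>m\<close> moves the pairing onto the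
    \<open>z i\<close>, and so onto \<open>f\<close> under the mean.\<close>
  have "r = r\<^sup>2 / r" using r by (simp add: power2_eq_square)
  also have "\<dots> = (\<Sum>s\<in>S. (m s \<bullet> m s) / r)"
    by (simp add: r2m power2_norm_eq_inner sum_divide_distrib)
  also have "\<dots> = (\<Sum>s\<in>S. \<Sum>i\<in>UNIV. z i s * ((v i \<bullet> m s) / r))"
  proof (rule sum.cong)
    fix s
    have "m s \<bullet> m s = (\<Sum>i\<in>UNIV. z i s * (v i \<bullet> m s))"
      unfolding m_def[of s] by (subst inner_sum_left) (simp add: m_def)
    then show "(m s \<bullet> m s) / r = (\<Sum>i\<in>UNIV. z i s * ((v i \<bullet> m s) / r))"
      by (simp add: sum_divide_distrib)
  qed simp
  also have "\<dots> = (\<Sum>i\<in>UNIV. \<Sum>s\<in>S. z i s * ((v i \<bullet> m s) / r))"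
    by (rule sum.swap)
  also have "\<dots> = cube_mean (pmf P) n (\<lambda>\<omega>. \<Sum>i\<in>UNIV. f \<omega> $ i * Y \<omega> $ i)"
    unfolding z_def level_one_def cube_mean_mult_right[symmetric] cube_mean_sum_distrib[symmetric]
    by (simp add: Yi sum_distrib_left mult_ac)
  also have "\<dots> \<le> cube_mean (pmf P) n (\<lambda>\<omega>. softmax \<theta> (Y \<omega>))"
  proof (rule cube_mean_mono)
    fix \<omega> :: "nat \<Rightarrow> 'k" assume "\<omega> \<in> cube n"
    then have fs: "\<And>i. f \<omega> $ i \<ge> 0" "(\<Sum>i\<in>UNIV. f \<omega> $ i) = 1"
      using f by (auto simp: prob_simplex_def)
    have "(\<Sum>i\<in>UNIV. f \<omega> $ i * Y \<omega> $ i) \<le> (\<Sum>i\<in>UNIV. f \<omega> $ i * softmax \<theta> (Y \<omega>))"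
      by (intro sum_mono mult_left_mono softmax_ge \<theta> fs)
    also have "\<dots> = softmax \<theta> (Y \<omega>)"
      unfolding sum_distrib_right[symmetric] fs by simp
    finally show "(\<Sum>i\<in>UNIV. f \<omega> $ i * Y \<omega> $ i) \<le> softmax \<theta> (Y \<omega>)" .
  qed
  also have "\<dots> \<le> avg (gauss d c) (softmax \<theta>) 0 + \<theta>\<^sup>2 * (H ^ 3 + gauss_third d) * (\<Sum>j<n. (\<Sum>l<d. norm (a j l)) ^ 3)"
    using lindeberg[where a = a and c = c and e = d and n = n and P = P, folded d_def, OF X H \<theta> cov]
    unfolding Y_def by simp
  also have "\<dots> \<le> (sqrt (C_max B) + ln CARD('k) / \<theta>)
      + \<theta>\<^sup>2 * (H ^ 3 + gauss_third d) * (real d ^ 2 * V ^ 4 * t / r)"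
  proof (intro add_mono mult_left_mono)
    show "avg (gauss d c) (softmax \<theta>) 0 \<le> sqrt (C_max B) + ln CARD('k) / \<theta>"
      unfolding c_def d_def by (rule avg_gauss_softmax_le[OF B m'1[unfolded d_def] \<theta>])
    show "0 \<le> \<theta>\<^sup>2 * (H ^ 3 + gauss_third d)"
      using H by (simp add: gauss_third_nonneg)
    have V: "V \<ge> 0" unfolding V_def by (intro sum_nonneg) auto
    have a1: "norm (a j l) \<le> V / r * norm (m (j, l))" for j l
    proof -
      have "norm (a j l) \<le> (\<Sum>i\<in>UNIV. \<bar>a j l $ i\<bar>)" by (rule norm_le_l1_cart)
      also have "\<dots> \<le> (\<Sum>i\<in>UNIV. norm (v i) * (norm (m (j, l)) / r))"
        using r Cauchy_Schwarz_ineq2[of _ "m (j, l)"]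
        by (intro sum_mono) (simp add: a_def abs_mult abs_divide divide_right_mono)
      also have "\<dots> = V / r * norm (m (j, l))"
        by (simp add: V_def sum_distrib_right sum_divide_distrib)
      finally show ?thesis .
    qed
    have m1: "norm (m s) \<le> V * t" if "s \<in> S" for s
    proof -
      have "norm (m s) \<le> (\<Sum>i\<in>UNIV. t * norm (v i))"
        unfolding m_def
        using t[of s] that by (intro sum_norm_le) (simp add: S_def z_def mult_right_mono)
      then show ?thesis by (simp add: V_def sum_distrib_left mult.commute)
    qed
    \<comment> \<open>The cubes are bounded by the maximum of \<open>w\<close> times the sum of its
      squares. The maximum supplies \<open>t / r\<close>; in the sum of squares the
      \<open>r\<^sup>2\<close> from \<open>r2m\<close> cancels the normalisation.\<close>
    define w where "w j = (\<Sum>l<d. norm (a j l))" for j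
    have w0: "w j \<ge> 0" for j unfolding w_def by (intro sum_nonneg) auto
    have w1: "w j \<le> real d * V\<^sup>2 * t / r" if "j < n" for j
    proof -
      have "w j \<le> (\<Sum>l<d. V / r * (V * t))"
        unfolding w_def using that r V
        by (intro sum_mono order_trans[OF a1] mult_left_mono m1) (auto simp: S_def)
      then show ?thesis by (simp add: power2_eq_square mult_ac)
    qed
    have w2: "(w j)\<^sup>2 \<le> real d * (\<Sum>l<d. (V / r * norm (m (j, l)))\<^sup>2)" for j
    proof -
      have "(w j)\<^sup>2 \<le> real d * (\<Sum>l<d. (norm (a j l))\<^sup>2)"
        unfolding w_def using sum_squared_le_sum_of_squares[of "\<lambda>l. norm (a j l)" "{..<d}"] by (simp add: mult.commute)
      also have "\<dots> \<le> real d * (\<Sum>l<d. (V / r * norm (m (j, l)))\<^sup>2)"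
        by (intro mult_left_mono sum_mono power_mono a1) auto
      finally show ?thesis .
    qed
    have "(\<Sum>j<n. (w j) ^ 3) = (\<Sum>j<n. w j * (w j)\<^sup>2)"
      by (simp add: power3_eq_cube power2_eq_square mult.assoc)
    also have "\<dots> \<le> (\<Sum>j<n. (real d * V\<^sup>2 * t / r) * (real d * (\<Sum>l<d. (V / r * norm (m (j, l)))\<^sup>2)))"
      by (intro sum_mono mult_mono w1 w2 order_trans[OF w0 w1]) auto
    also have "\<dots> = (real d * V\<^sup>2 * t / r) * (real d * ((V / r)\<^sup>2 * (\<Sum>s\<in>S. (norm (m s))\<^sup>2)))"
      by (simp add: S_def power_mult_distrib power_divide sum_distrib_left sum.cartesian_product case_prod_beta')
    also have "\<dots> = real d ^ 2 * V ^ 4 * t / r"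
      unfolding r2m[symmetric] using r by (simp add: field_simps eval_nat_numeral)
    finally show "(\<Sum>j<n. (\<Sum>l<d. norm (a j l)) ^ 3) \<le> real d ^ 2 * V ^ 4 * t / r"
      unfolding w_def .
  qed
  finally show ?thesis by simp
qed

section \<open>Choice of the constants and conclusion\<close>

theorem theorem5p4:
  fixes B :: "real^'k^'k"
    and v :: "'k \<Rightarrow> real^'k"
    and w :: "real^'k"
    and R \<beta> :: real
    and p :: "'k pmf"
    and \<mu> :: "'k \<Rightarrow> real"
    and X :: "nat \<Rightarrow> 'k \<Rightarrow> real"
  assumes "transpose B = B"
    and "positive_semidefinite B"
    and "\<And>i j. B $ i $ j = v i \<bullet> v j"
    and "is_smallest_ball w R (range v)"
    and "w = (\<Sum>i\<in>UNIV. pmf p i *\<^sub>R v i)"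
    and "\<And>i. pmf p i \<noteq> 0 \<Longrightarrow> norm (v i - w) = R"
    and "0 < \<beta>" and "\<beta> < 1"
    and "\<And>i. \<mu> i = (1 - \<beta>) * pmf p i + \<beta> / real CARD('k)"
    and "X 0 = (\<lambda>_. 1)"
    and "orthonormal_basis_L2 \<mu> X"
  shows "\<forall>\<epsilon>>0. \<exists>\<tau>>0. \<forall>n. \<forall>f :: (nat \<Rightarrow> 'k) \<Rightarrow> real^'k.
           (\<forall>\<omega>\<in>cube n. f \<omega> \<in> prob_simplex) \<longrightarrow>
           (\<forall>i. \<forall>j<n. low_degree_influence X n (ln (1 / \<tau>)) j (\<lambda>\<omega>. f \<omega> $ i) \<le> \<tau>) \<longrightarrow>
           OBJ B X n f \<le> C_max B + \<epsilon>"
proof (intro allI impI)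
  fix \<epsilon> :: real assume \<epsilon>: "\<epsilon> > 0"
  note B = assms(3) and X0 = assms(10) and X = assms(11)
  define d where "d = CARD('k) - 1"
  define V where "V = (\<Sum>i\<in>UNIV. norm (v i))"
  have \<mu>0: "\<mu> i \<ge> 0" for i using assms(7-9) by simp
  have "(\<Sum>i\<in>UNIV. \<mu> i) = (1 - \<beta>) * (\<Sum>i\<in>UNIV. pmf p i) + \<beta>"
    by (simp add: assms(9) sum.distrib sum_distrib_left)
  then have \<mu>1: "(\<Sum>i\<in>UNIV. \<mu> i) = 1" by (simp add: sum_pmf_eq_1)
  \<comment> \<open>The averaging lemmas speak about a \<open>pmf\<close>, so \<mu> is turned into
    one.\<close>
  define P where "P = embed_pmf \<mu>"
  have P: "pmf P = \<mu>"
    unfolding P_def using \<mu>0 \<mu>1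
    by (intro ext pmf_embed_pmf) (simp_all add: nn_integral_count_space_finite sum_ennreal)
  \<comment> \<open>Inserting 0 keeps the maximum defined for a one-letter alphabet, where
    \<open>d\<close> is 0.\<close>
  define H where "H = Max (insert 0 ((\<lambda>(l, i). \<bar>X (Suc l) i\<bar>) ` ({..<d} \<times> UNIV)))"
  have fin: "finite (insert 0 ((\<lambda>(l, i). \<bar>X (Suc l) i\<bar>) ` ({..<d} \<times> UNIV)))" by simp
  have H: "H \<ge> 0" "\<And>l i. l < d \<Longrightarrow> \<bar>X (Suc l) i\<bar> \<le> H"
    unfolding H_def by (rule Max_ge[OF fin], force)+
  \<comment> \<open>With \<open>m\<close> equal to zero the Gaussian maximum is 0.\<close>
  have C: "C_max B \<ge> 0"
  proof -
    have "0 \<le> sqrt (C_max B)"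
      using gaussian_max_le_C_max(2)[OF B, of "\<lambda>_. 0"] by simp
    then show ?thesis by simp
  qed
  \<comment> \<open>Chosen so that \<open>r \<le> sqrt (C_max B) + \<delta>\<close> squares to at
    most \<open>C_max B + \<epsilon>\<close>; the bound \<delta> \<le> 1 handles the quadratic
    term.\<close>
  define \<delta> where "\<delta> = min 1 (\<epsilon> / (2 * sqrt (C_max B) + 1))"
  have \<delta>: "\<delta> > 0" "\<delta> \<le> 1" "\<delta> * (2 * sqrt (C_max B) + 1) \<le> \<epsilon>"
    using \<epsilon> C by (auto simp: \<delta>_def min_def field_simps add_pos_nonneg)
  have lnk: "ln (real CARD('k)) \<ge> 0" by (intro ln_ge_zero) (simp add: Suc_leI)
  \<comment> \<open>Makes the smoothing error at most half of \<delta>; the added 1 keeps \<theta>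
    positive when the logarithm is 0.\<close>
  define \<theta> where "\<theta> = 2 * (ln (real CARD('k)) + 1) / \<delta>"
  have \<theta>: "\<theta> > 0" using \<delta> lnk unfolding \<theta>_def by (intro divide_pos_pos mult_pos_pos add_nonneg_pos) auto
  have ln_\<theta>: "ln (real CARD('k)) / \<theta> \<le> \<delta> / 2"
  proof -
    have "ln (real CARD('k)) / \<theta> = \<delta> / 2 * (ln (real CARD('k)) / (ln (real CARD('k)) + 1))"
      by (simp add: \<theta>_def)
    also have "\<dots> \<le> \<delta> / 2"
      using \<delta> by (intro mult_left_le divide_le_eq_1_pos[THEN iffD2] add_nonneg_pos lnk) auto
    finally show ?thesis .
  qed
  define L where "L = \<theta>\<^sup>2 * (H ^ 3 + gauss_third d) * (real d ^ 2 * V ^ 4)"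
  have L: "L \<ge> 0" using H by (simp add: L_def gauss_third_nonneg)
  \<comment> \<open>The first bound gives \<open>ln (1 / \<tau>) \<ge> 1\<close>, so that the
    influences see level one. The second makes the replacement error at most half of \<delta> once
    \<open>r \<ge> sqrt \<epsilon>\<close>; \<open>L + 1\<close> avoids a zero denominator.\<close>
  define \<tau> where "\<tau> = min (exp (- 1)) (\<epsilon> * (\<delta> / (2 * (L + 1)))\<^sup>2)"
  have \<tau>: "\<tau> > 0" using \<epsilon> \<delta> L by (simp add: \<tau>_def)
  have "exp 1 \<le> 1 / \<tau>"
    using \<tau> by (auto simp: \<tau>_def exp_minus field_simps min_def)
  then have ln\<tau>: "1 \<le> ln (1 / \<tau>)"
    using \<tau> by (simp add: ln_ge_iff)
  have "sqrt \<tau> \<le> sqrt (\<epsilon> * (\<delta> / (2 * (L + 1)))\<^sup>2)"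
    unfolding \<tau>_def by (intro real_sqrt_le_mono) simp
  also have "\<dots> = sqrt \<epsilon> * (\<delta> / (2 * (L + 1)))"
    using \<delta> L by (simp add: real_sqrt_mult)
  finally have sqrt_\<tau>: "sqrt \<tau> \<le> sqrt \<epsilon> * (\<delta> / (2 * (L + 1)))" .
  show "\<exists>\<tau>>0. \<forall>n. \<forall>f :: (nat \<Rightarrow> 'k) \<Rightarrow> real^'k.
           (\<forall>\<omega>\<in>cube n. f \<omega> \<in> prob_simplex) \<longrightarrow>
           (\<forall>i. \<forall>j<n. low_degree_influence X n (ln (1 / \<tau>)) j (\<lambda>\<omega>. f \<omega> $ i) \<le> \<tau>) \<longrightarrow>
           OBJ B X n f \<le> C_max B + \<epsilon>"
  proof (intro exI[of _ \<tau>] conjI \<tau> allI impI)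
    fix n and f :: "(nat \<Rightarrow> 'k) \<Rightarrow> real^'k"
    assume f: "\<forall>\<omega>\<in>cube n. f \<omega> \<in> prob_simplex"
      and inf: "\<forall>i. \<forall>j<n. low_degree_influence X n (ln (1 / \<tau>)) j (\<lambda>\<omega>. f \<omega> $ i) \<le> \<tau>"
    show "OBJ B X n f \<le> C_max B + \<epsilon>"
    \<comment> \<open>The replacement error carries a factor 1/\<open>r\<close>, so a small
      objective is treated apart, where \<open>C_max B \<ge> 0\<close> is enough.\<close>
    proof (cases "OBJ B X n f \<le> \<epsilon>")
      case True
      then show ?thesis using C by simp
    next
      case False
      define r where "r = sqrt (OBJ B X n f)"
      have r: "r > 0" "sqrt \<epsilon> \<le> r" using False \<epsilon> by (simp_all add: r_def)
      have t: "\<bar>level_one (pmf P) X n (\<lambda>\<omega>. f \<omega> $ i) s\<bar> \<le> sqrt \<tau>" if st: "s \<in> {..<n} \<times> {..<d}" for i s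
      proof -
        obtain j l where s: "s = (j, l)" "j < n" "l < CARD('k) - 1"
          using st by (auto simp: d_def)
        have "(level_one (pmf P) X n (\<lambda>\<omega>. f \<omega> $ i) (j, l))\<^sup>2 \<le> low_degree_influence X n (ln (1 / \<tau>)) j (\<lambda>\<omega>. f \<omega> $ i)"
          by (rule level_one_le_influence) (use X X0 s ln\<tau> in \<open>auto simp: P\<close>)
        also have "\<dots> \<le> \<tau>" using inf s by blast
        finally show ?thesis using s by (simp add: real_le_rsqrt)
      qed
      have "r \<le> sqrt (C_max B) + ln (real CARD('k)) / \<theta> +
          \<theta>\<^sup>2 * (H ^ 3 + gauss_third d) * (real d ^ 2 * V ^ 4 * sqrt \<tau> / r)"
        unfolding r_def d_def V_def
        by (rule sqrt_OBJ_le[OF B, where P = P])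
          (use X X0 H \<theta> f t r in \<open>auto simp: P d_def r_def\<close>)
      also have "\<theta>\<^sup>2 * (H ^ 3 + gauss_third d) * (real d ^ 2 * V ^ 4 * sqrt \<tau> / r) = L * (sqrt \<tau> / r)"
        by (simp add: L_def)
      also have "L * (sqrt \<tau> / r) \<le> \<delta> / 2"
      proof -
        have "sqrt \<tau> / r \<le> \<delta> / (2 * (L + 1))"
        proof -
          have "sqrt \<tau> \<le> r * (\<delta> / (2 * (L + 1)))"
            using sqrt_\<tau> r \<delta> L by (elim order_trans) (intro mult_right_mono, auto)
          then show ?thesis using r by (simp add: divide_le_eq mult.commute)
        qed
        then have "L * (sqrt \<tau> / r) \<le> L * (\<delta> / (2 * (L + 1)))"
          by (rule mult_left_mono[OF _ L])
        also have "\<dots> \<le> \<delta> / 2"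
          using \<delta> L by (simp add: field_simps)
        finally show ?thesis .
      qed
      finally have "r \<le> sqrt (C_max B) + \<delta>" using ln_\<theta> by linarith
      then have "r\<^sup>2 \<le> (sqrt (C_max B) + \<delta>)\<^sup>2" using r by (intro power_mono) auto
      also have "\<dots> = C_max B + \<delta> * (2 * sqrt (C_max B) + \<delta>)"
        using C by (simp add: power2_sum algebra_simps power2_eq_square[of \<delta>])
      also have "\<dots> \<le> C_max B + \<delta> * (2 * sqrt (C_max B) + 1)"
        using \<delta> by (intro add_left_mono mult_left_mono) auto
      finally show ?thesis
        using \<delta>(3) False \<epsilon> by (simp add: r_def)
    qed
  qed
qed

end
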